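(* Let $(X,S,\mathcal{A})$ be a stationarily measurable space with type monoid $\mathcal{T}=\mathcal{T}(X,S,\mathcal{A})$ and Tarski measure $m:\mathcal{A}\to\mathcal{T}$, $m(A)=[A]$. - (Monotonicity) If $A,B\in\mathcal{A}$ and $A\subseteq B$, then $m(A)\preceq m(B)$. - (Subadditivity) If $\{A_i\}_{i=1}^\infty\subseteq\mathcal{A}$, then $m\left(\bigcup_{i=1}^\infty A_i\right)\preceq\sum_{i=1}^\infty m(A_i)$. - (Continuity from below) If $\{A_i\}_{i=1}^\infty\subseteq\mathcal{A}$ and $A_1\subseteq A_2\subseteq\cdots$, then $\varinjlim m(A_i)=m\left(\bigcup_{i=1}^\infty A_i\right)$. - (Continuity from above) If $\{A_i\}_{i=1}^\infty\subseteq\mathcal{A}$ and $A_1\supseteq A_2\supseteq\cdots$, then $\varprojlim m(A_i)=m\left(\bigcap_{i=1}^\infty A_i\right)+e$, provided there exist $N\in\mathbb{N}$ and $e\in\mathrm{E}(\mathcal{T})$ such that $m(A_n)\in\mathcal{T}_e$ for all $n\geq N$, where $\mathcal{T}_e$ is the isotropy monoid of $e$.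
   Context: An inverse monoid is a monoid $S$ in which every $s$ has a unique weak inverse $s^*$ with $ss^*s=s$ and $s^*ss^*=s^*$. A stationarily measurable space $(X,S,\mathcal{A})$ consists of a set $X$ with a $\sigma$-algebra $\mathcal{A}$ of subsets and an inverse monoid $S$ acting on $X$ from the left by measurable maps: $1$ acts as the identity, $(st)x=s(tx)$, and each map $x\mapsto sx$ is $(\mathcal{A},\mathcal{A})$-measurable. For $s\in S$ and $A\in\mathcal{A}$, $s^{-1}A=\{x\in X: sx\in A\}$ is the preimage. $\overline{\mathcal{A}}$ denotes the closure of $\mathcal{A}$ under countable coproducts (disjoint unions): its elements are the coproducts $\coprod_{j\in J}P_j$ with $J$ countable and $P_j\in\mathcal{A}$ (realized as $\bigcup_j P_j\times\{j\}$). The representation is unique up to measurable partitions: $\coprod_j P_j$ and $\coprod_k Q_k$ are the same element when there are $R_{jk}\in\mathcal{A}$ with $P_j=\bigsqcup_k R_{jk}$ and $Q_k=\bigsqcup_j R_{jk}$; in particular $A\in\mathcal{A}$ is identified with $\coprod_j A_j$ for any countable measurable partition $(A_j)$ of $A$. $S$ acts by $s^{-1}\left(\coprod_j P_j\right)=\coprod_j s^{-1}P_j$. For $P,Q\in\overline{\mathcal{A}}$, write $P\eqsim_S Q$ iff there are countable collections $(P_j),(Q_j)\subseteq\overline{\mathcal{A}}$ and $(s_j),(t_j)\subseteq S$ with $P=\coprod_j P_j$, $Q=\coprod_j Q_j$ and $s_j^{-1}P_j=t_j^{-1}Q_j$ for all $j$. The type monoid is $\mathcal{T}=\overline{\mathcal{A}}/\eqsim_S=\{[P]:P\in\overline{\mathcal{A}}\}$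 with $[P]+[Q]=[P\coprod Q]$, countable sums $\sum_j[P_j]=\left[\coprod_j P_j\right]$, and $0=[\varnothing]$. It is ordered by $\alpha\preceq\beta\iff\exists\gamma\in\mathcal{T}$ with $\alpha+\gamma=\beta$ (a partial order). $\mathrm{E}(\mathcal{T})=\{e\in\mathcal{T}:e+e=e\}$. For $a\in\mathcal{T}$, $\uparrow_a=\{b\in\mathcal{T}:a\preceq b\}$. The isotropy monoid of $e\in\mathrm{E}(\mathcal{T})$ is $\mathcal{T}_e=\uparrow_e\setminus\bigcup\{\uparrow_f: f\in\mathrm{E}(\mathcal{T}),\ e\preceq f,\ f\neq e\}$. $\mathcal{T}$ is viewed as a category via its partial order, so for an increasing sequence $\varinjlim$ is the supremum and for a decreasing sequence $\varprojlim$ is the infimum; the asserted equalities include the existence of these limits. *)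

theory Defs
  imports "HOL-Analysis.Sigma_Algebra" "HOL-Library.Nat_Bijection" "HOL-Algebra.Group" "HOL-Algebra.Order"
begin

locale inverse_monoid = monoid S for S (structure) +
  assumes ex1_weak_inverse:
    "s \<in> carrier S \<Longrightarrow> \<exists>!t. t \<in> carrier S \<and> s \<otimes> t \<otimes> s = s \<and> t \<otimes> s \<otimes> t = t"

text \<open>The measurable space is \<open>(space M, sets M)\<close>; the measure carried by \<open>M\<close> plays no role.\<close>

locale stationarily_measurable_space = inverse_monoid S
  for M :: "'x measure" and S :: "('s, 'r) monoid_scheme" (structure)
    and act :: "'s \<Rightarrow> 'x \<Rightarrow> 'x" +
  assumes act_measurable: "s \<in> carrier S \<Longrightarrow> act s \<in> measurable M M"
    and act_one: "x \<in> space M \<Longrightarrow> act \<one> x = x"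
    and act_mult: "s \<in> carrier S \<Longrightarrow> t \<in> carrier S \<Longrightarrow> x \<in> space M \<Longrightarrow>
      act (s \<otimes> t) x = act s (act t x)"

text \<open>A countable coproduct of measurable sets is represented by a family indexed by \<open>nat\<close>; a
  coproduct over a smaller countable index set is padded with copies of the empty set.
  Two families represent the same coproduct iff they are related by \<open>coprod_eq\<close> below. Equality of coproducts
  is kept as this relation on families; \<open>type_monoid\<close> passes to classes once, for the coarser
  relation \<open>type_rel\<close>.\<close>

type_synonym 'x family = "nat \<Rightarrow> 'x set"

definition families :: "'x measure \<Rightarrow> 'x family set" where
  "families M = {P. \<forall>j. P j \<in> sets M}"

definition coprod_eq :: "'x measure \<Rightarrow> 'x family \<Rightarrow> 'x family \<Rightarrow> bool" where
  "coprod_eq M P Q \<longleftrightarrow> (\<exists>R :: nat \<Rightarrow> nat \<Rightarrow> 'x set.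
     (\<forall>j k. R j k \<in> sets M) \<and>
     (\<forall>j. disjoint_family (\<lambda>k. R j k) \<and> P j = (\<Union>k. R j k)) \<and>
     (\<forall>k. disjoint_family (\<lambda>j. R j k) \<and> Q k = (\<Union>j. R j k)))"

definition empty_family :: "'x family" where
  "empty_family = (\<lambda>_. {})"

definition single_family :: "'x set \<Rightarrow> 'x family" where
  "single_family A = (\<lambda>j. if j = 0 then A else {})"

text \<open>The coproduct of a sequence of families is reindexed along the bijection
  \<open>prod_decode\<close> from \<open>nat\<close> to \<open>nat \<times> nat\<close>.\<close>

definition Coprod :: "(nat \<Rightarrow> 'x family) \<Rightarrow> 'x family" where
  "Coprod P = (\<lambda>n. case prod_decode n of (i, j) \<Rightarrow> P i j)"

definition coprod :: "'x family \<Rightarrow> 'x family \<Rightarrow> 'x family" where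
  "coprod P Q = Coprod (\<lambda>i. if i = 0 then P else if i = 1 then Q else empty_family)"

definition family_vimage :: "'x measure \<Rightarrow> ('x \<Rightarrow> 'x) \<Rightarrow> 'x family \<Rightarrow> 'x family" where
  "family_vimage M f P = (\<lambda>j. f -` P j \<inter> space M)"

definition type_rel :: "'x measure \<Rightarrow> ('s, 'r) monoid_scheme \<Rightarrow> ('s \<Rightarrow> 'x \<Rightarrow> 'x) \<Rightarrow>
    'x family rel" where
  "type_rel M S act = {(P, Q). P \<in> families M \<and> Q \<in> families M \<and>
     (\<exists>(P' :: nat \<Rightarrow> 'x family) (Q' :: nat \<Rightarrow> 'x family) (s :: nat \<Rightarrow> 's) (t :: nat \<Rightarrow> 's).
        (\<forall>j. P' j \<in> families M \<and> Q' j \<in> families M \<and> s j \<in> carrier S \<and> t j \<in> carrier S) \<and>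
        coprod_eq M P (Coprod P') \<and> coprod_eq M Q (Coprod Q') \<and>
        (\<forall>j. coprod_eq M (family_vimage M (act (s j)) (P' j))
                         (family_vimage M (act (t j)) (Q' j))))}"

text \<open>The addition of the type monoid is the multiplication of the monoid record, and its zero
  is \<open>one\<close>. The operations on classes range over all representatives.\<close>

definition type_monoid :: "'x measure \<Rightarrow> ('s, 'r) monoid_scheme \<Rightarrow> ('s \<Rightarrow> 'x \<Rightarrow> 'x) \<Rightarrow>
    'x family set monoid" where
  "type_monoid M S act =
     \<lparr>carrier = families M // type_rel M S act,
      mult = (\<lambda>\<alpha> \<beta>. type_rel M S act `` {coprod P Q | P Q. P \<in> \<alpha> \<and> Q \<in> \<beta>}),
      one = type_rel M S act `` {empty_family}\<rparr>"

definition type_sum :: "'x measure \<Rightarrow> ('s, 'r) monoid_scheme \<Rightarrow> ('s \<Rightarrow> 'x \<Rightarrow> 'x) \<Rightarrow>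
    (nat \<Rightarrow> 'x family set) \<Rightarrow> 'x family set" where
  "type_sum M S act \<alpha> = type_rel M S act `` {Coprod P | P. \<forall>i. P i \<in> \<alpha> i}"

definition tarski_measure :: "'x measure \<Rightarrow> ('s, 'r) monoid_scheme \<Rightarrow> ('s \<Rightarrow> 'x \<Rightarrow> 'x) \<Rightarrow>
    'x set \<Rightarrow> 'x family set" where
  "tarski_measure M S act A = type_rel M S act `` {single_family A}"

definition alg_order :: "('t, 'r) monoid_scheme \<Rightarrow> 't gorder" where
  "alg_order T = \<lparr>carrier = carrier T, eq = (=),
     le = (\<lambda>a b. \<exists>c \<in> carrier T. a \<otimes>\<^bsub>T\<^esub> c = b)\<rparr>"

definition idempotents :: "('t, 'r) monoid_scheme \<Rightarrow> 't set" where
  "idempotents T = {e \<in> carrier T. e \<otimes>\<^bsub>T\<^esub> e = e}"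

definition up_set :: "('t, 'r) monoid_scheme \<Rightarrow> 't \<Rightarrow> 't set" where
  "up_set T a = {b \<in> carrier T. a \<sqsubseteq>\<^bsub>alg_order T\<^esub> b}"

definition isotropy_monoid :: "('t, 'r) monoid_scheme \<Rightarrow> 't \<Rightarrow> 't set" where
  "isotropy_monoid T e =
     up_set T e - \<Union> {up_set T f | f. f \<in> idempotents T \<and> e \<sqsubseteq>\<^bsub>alg_order T\<^esub> f \<and> f \<noteq> e}"

end

theory Submission
  imports Defs "HOL-Algebra.FiniteProduct" "HOL-Algebra.Lattice"
    "HOL-Analysis.Caratheodory" "HOL-Analysis.Nonnegative_Lebesgue_Integration"
begin

text \<open>
  A coproduct of measurable sets is determined by how often it covers each point: \<open>coprod_eq\<close> holds
  for two families exactly when their multiplicity functions, with values in the natural numbers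
  and \<open>\<infinity>\<close>, agree (\<open>coprod_eq_iff_tally\<close>). Coproducts thereby turn into measurable integer-valued
  functions, countable coproducts into pointwise sums, and preimages into composition with the
  action. Two functions have the same type iff they split into countably many summands that can be
  matched in pairs, the partners becoming equal after being pulled back along elements of the
  monoid (\<open>equidec\<close>).

  For this relation the inverse monoid is as good as a group. If \<open>e\<close> is idempotent, then \<open>f\<close> and
  \<open>f \<circ> e\<close> differ on a set whose preimage under \<open>e\<close> is empty, and such a set has type zero; since
  idempotents commute, any two elements have a common right multiple. The first fact allows a
  splitting of one function to be copied to an equivalent one (\<open>equidec_lift\<close>), the second makes
  the relation transitive. Together with the fact that a decreasing sequence of integer-valued
  functions has an integer-valued infimum, this shows that the type monoid is a cardinal algebra
  in the sense of Tarski (\<open>cardinal_algebra_type_monoid\<close>).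

  What remains is arithmetic in cardinal algebras. Its core is a cancellation law: \<open>a + b = a + c\<close>
  implies \<open>b + z = c + z\<close> for some idempotent \<open>z\<close> that \<open>a\<close> absorbs (\<open>cancel_modulo_absorbed\<close>). From it
  follows that an upper bound of all finite partial sums of a series bounds the whole series
  (\<open>Sum_below\<close>), which is continuity from below. For continuity from above, write the types of the
  sets as \<open>a\<^sub>n = a + (d\<^sub>n + d\<^sub>n\<^sub>+\<^sub>1 + \<dots>)\<close>, where \<open>a\<close> is the type of the intersection and \<open>d\<^sub>n\<close> is the type
  of the \<open>n\<close>-th difference. If \<open>c\<close> lies below every \<open>a\<^sub>n\<close>, then \<open>c + (d\<^sub>N + \<dots> + d\<^sub>n) \<preceq> a\<^sub>N\<close> for all \<open>n\<close>,
  hence \<open>c + (d\<^sub>N + d\<^sub>N\<^sub>+\<^sub>1 + \<dots>) \<preceq> a + (d\<^sub>N + d\<^sub>N\<^sub>+\<^sub>1 + \<dots>)\<close>. Inside the isotropy monoid of \<open>e\<close> the absorbed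
  idempotents of the cancellation law are already absorbed by \<open>e\<close>, so the series cancels up to \<open>e\<close>
  and \<open>c \<preceq> a + e\<close> is left (\<open>Sum_tails_is_glb\<close>).
\<close>

section \<open>Arithmetic of cardinal algebras\<close>

text \<open>The multiplication of the record is the addition of the algebra, and \<open>Sum\<close> adds up sequences.
  Besides unfolding and termwise addition of series, the axioms are Tarski's refinement and
  remainder postulates. Rearranging a series is represented by the single instance
  \<open>\<infinity>x + \<infinity>x = \<infinity>x\<close>, where \<open>\<infinity>x\<close> is the sum of infinitely many copies of \<open>x\<close>. Finite partial sums
  appear as \<open>finprod T a {..n}\<close>.\<close>

locale cardinal_algebra = comm_monoid T for T (structure) +
  fixes Sum :: "(nat \<Rightarrow> 'a) \<Rightarrow> 'a"
  assumes Sum_closed [simp]: "\<And>a. (\<And>n. a n \<in> carrier T) \<Longrightarrow> Sum a \<in> carrier T"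
    and Sum_unfold: "\<And>a. (\<And>n. a n \<in> carrier T) \<Longrightarrow> Sum a = a 0 \<otimes> Sum (\<lambda>n. a (Suc n))"
    and Sum_mult: "\<And>a b. (\<And>n. a n \<in> carrier T) \<Longrightarrow> (\<And>n. b n \<in> carrier T) \<Longrightarrow>
      Sum (\<lambda>n. a n \<otimes> b n) = Sum a \<otimes> Sum b"
    and Sum_const_idem: "\<And>x. x \<in> carrier T \<Longrightarrow> Sum (\<lambda>_. x) \<otimes> Sum (\<lambda>_. x) = Sum (\<lambda>_. x)"
    and refinement: "\<And>a b c d. a \<in> carrier T \<Longrightarrow> b \<in> carrier T \<Longrightarrow> c \<in> carrier T \<Longrightarrow> d \<in> carrier T \<Longrightarrow>
      a \<otimes> b = c \<otimes> d \<Longrightarrow>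
      \<exists>p q r s. p \<in> carrier T \<and> q \<in> carrier T \<and> r \<in> carrier T \<and> s \<in> carrier T \<and>
        a = p \<otimes> q \<and> b = r \<otimes> s \<and> c = p \<otimes> r \<and> d = q \<otimes> s"
    and remainder: "\<And>a b. (\<And>n. a n \<in> carrier T) \<Longrightarrow> (\<And>n. b n \<in> carrier T) \<Longrightarrow>
      (\<And>n. a n = b n \<otimes> a (Suc n)) \<Longrightarrow>
      \<exists>c \<in> carrier T. \<forall>n. a n = c \<otimes> Sum (\<lambda>i. b (n + i))"
begin

abbreviation below :: "'a \<Rightarrow> 'a \<Rightarrow> bool" (infixl "\<preceq>" 50) where
  "a \<preceq> b \<equiv> a \<sqsubseteq>\<^bsub>alg_order T\<^esub> b"

abbreviation omega :: "'a \<Rightarrow> 'a" where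
  "omega x \<equiv> Sum (\<lambda>_. x)"

lemma below_iff: "a \<preceq> b \<longleftrightarrow> (\<exists>c \<in> carrier T. a \<otimes> c = b)"
  by (simp add: alg_order_def)

lemma belowI: "c \<in> carrier T \<Longrightarrow> a \<otimes> c = b \<Longrightarrow> a \<preceq> b"
  by (auto simp: below_iff)

lemma below_mult_right [simp]: "c \<in> carrier T \<Longrightarrow> a \<preceq> a \<otimes> c"
  by (rule belowI) simp_all

lemma below_mult_left [simp]: "a \<in> carrier T \<Longrightarrow> c \<in> carrier T \<Longrightarrow> a \<preceq> c \<otimes> a"
  by (rule belowI) (simp_all add: m_comm)

lemma below_refl [simp]: "a \<in> carrier T \<Longrightarrow> a \<preceq> a"
  by (rule belowI[of \<one>]) simp_all

lemma below_trans:
  assumes "a \<in> carrier T" "a \<preceq> b" "b \<preceq> c"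
  shows "a \<preceq> c"
  using assms unfolding below_iff by (metis m_assoc m_closed)

lemma below_mult:
  assumes "a \<in> carrier T" "c \<in> carrier T" "a \<preceq> b" "c \<preceq> d"
  shows "a \<otimes> c \<preceq> b \<otimes> d"
proof -
  obtain x y where "x \<in> carrier T" "y \<in> carrier T" "b = a \<otimes> x" "d = c \<otimes> y"
    using assms by (auto simp: below_iff)
  then show ?thesis
    using assms by (intro belowI[of "x \<otimes> y"]) (simp_all add: m_ac)
qed

lemma Sum_mono:
  assumes "\<And>n. a n \<in> carrier T" "\<And>n. a n \<preceq> b n"
  shows "Sum a \<preceq> Sum b"
proof -
  obtain c where c: "\<And>n. c n \<in> carrier T" "\<And>n. a n \<otimes> c n = b n"
    using assms(2) unfolding below_iff by metis
  have "Sum a \<otimes> Sum c = Sum b"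
    using Sum_mult[of a c] assms(1) c by simp
  then show ?thesis
    using c(1) by (intro belowI) auto
qed

lemma mult_omega_self: "x \<in> carrier T \<Longrightarrow> x \<otimes> omega x = omega x"
  using Sum_unfold[of "\<lambda>_. x"] by simp

lemma omega_idempotent: "x \<in> carrier T \<Longrightarrow> omega x \<in> idempotents T"
  by (simp add: idempotents_def Sum_const_idem)

lemma idempotent_mult:
  assumes "e \<in> idempotents T" "f \<in> idempotents T"
  shows "e \<otimes> f \<in> idempotents T"
proof -
  have "e \<in> carrier T" "f \<in> carrier T"
    using assms by (simp_all add: idempotents_def)
  then have "(e \<otimes> f) \<otimes> (e \<otimes> f) = (e \<otimes> e) \<otimes> (f \<otimes> f)"
    by (simp add: m_ac)
  then show ?thesis
    using assms by (simp add: idempotents_def)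
qed

lemma idempotent_below_absorbed:
  assumes "e \<in> idempotents T" "e \<preceq> x"
  shows "x \<otimes> e = x"
proof -
  obtain c where c: "c \<in> carrier T" "x = e \<otimes> c"
    using assms(2) by (auto simp: below_iff)
  have e: "e \<in> carrier T" "e \<otimes> e = e"
    using assms(1) by (simp_all add: idempotents_def)
  have "x \<otimes> e = e \<otimes> e \<otimes> c"
    using c(1) e(1) by (simp add: c(2) m_ac)
  then show ?thesis
    by (simp add: c(2) e(2))
qed

text \<open>Removing one \<open>z n\<close> after the other from \<open>x\<close> never changes \<open>x\<close>, so the remainder postulate applies to
  the constant sequence \<open>x\<close> and puts the whole series below \<open>x\<close>.\<close>

lemma absorb_Sum_idempotents:
  assumes x: "x \<in> carrier T" and z: "\<And>n. z n \<in> idempotents T" and abs: "\<And>n. x \<otimes> z n = x"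
  shows "x \<otimes> Sum z = x" "Sum z \<in> idempotents T"
proof -
  have oc: "z n \<in> carrier T" and oo: "z n \<otimes> z n = z n" for n
    using z by (auto simp: idempotents_def)
  have idem: "Sum z \<otimes> Sum z = Sum z"
    using Sum_mult[of z z] oc oo by simp
  then show id: "Sum z \<in> idempotents T"
    using oc by (auto simp: idempotents_def)
  have "x = z n \<otimes> x" for n
    using abs[of n] x oc[of n] by (simp add: m_comm)
  then obtain c where c: "c \<in> carrier T" "x = c \<otimes> Sum (\<lambda>i. z (0 + i))"
    using remainder[of "\<lambda>_. x" z, OF x oc] by blast
  then have "Sum z \<preceq> x"
    using oc by (intro belowI[of c]) (simp_all add: m_comm)
  then show "x \<otimes> Sum z = x"
    using id by (rule idempotent_below_absorbed[rotated])
qed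

text \<open>The Euclidean algorithm for \<open>a + b = a + c\<close>. Refining the equation yields
  \<open>a = p + y = p + x\<close>, \<open>b = s + x\<close> and \<open>c = s + y\<close>, so that \<open>(p, x, y)\<close> again satisfies the equation and
  a common part \<open>s\<close> of \<open>b\<close> and \<open>c\<close> has been split off. Iterating, the remainder postulate turns \<open>b\<close> and \<open>c\<close>
  into \<open>v + (s\<^sub>0 + s\<^sub>1 + \<dots>)\<close> and \<open>w + (s\<^sub>0 + s\<^sub>1 + \<dots>)\<close>. As every step removes from \<open>a\<close> something above
  \<open>v\<close>, and likewise something above \<open>w\<close>, infinitely many copies of either are absorbed by \<open>a\<close>.\<close>

lemma cancel_modulo_absorbed:
  assumes a: "a \<in> carrier T" and b: "b \<in> carrier T" and c: "c \<in> carrier T"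
    and eq: "a \<otimes> b = a \<otimes> c"
  obtains z where "z \<in> idempotents T" "a \<otimes> z = a" "b \<otimes> z = c \<otimes> z"
proof -
  define ok where "ok = (\<lambda>(p, x, y). p \<in> carrier T \<and> x \<in> carrier T \<and> y \<in> carrier T \<and> p \<otimes> x = p \<otimes> y)"
  define link where "link = (\<lambda>(p, x, y) (p', x', y').
    p = x' \<otimes> p' \<and> p = y' \<otimes> p' \<and> (\<exists>s \<in> carrier T. x = s \<otimes> x' \<and> y = s \<otimes> y'))"
  have step: "\<exists>v. ok v \<and> link u v" if "ok u" for u
  proof -
    obtain p x y where u: "u = (p, x, y)" by (cases u)
    then have pxy: "p \<in> carrier T" "x \<in> carrier T" "y \<in> carrier T" "p \<otimes> x = p \<otimes> y"
      using that by (simp_all add: ok_def)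
    obtain p' q r s where
      c: "p' \<in> carrier T" "q \<in> carrier T" "r \<in> carrier T" "s \<in> carrier T" and
      e: "p = p' \<otimes> q" "x = r \<otimes> s" "p = p' \<otimes> r" "y = q \<otimes> s"
      using refinement[OF pxy(1,2,1,3,4)] by blast
    \<comment> \<open>Exchanging \<open>q\<close> and \<open>r\<close> makes both entries shrink by the same \<open>s\<close>: \<open>r\<close> is a part of \<open>x\<close> and \<open>q\<close> one of \<open>y\<close>.\<close>
    have "ok (p', r, q)"
      using c e(1)[symmetric] e(3) by (simp add: ok_def)
    moreover have "link u (p', r, q)"
      unfolding link_def u prod.case using c e by (metis m_comm)
    ultimately show ?thesis by blast
  qed
  have "\<exists>u. \<forall>n. (ok (u n) \<and> (n = 0 \<longrightarrow> u n = (a, b, c))) \<and> link (u n) (u (Suc n))"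
  proof (rule dependent_nat_choice)
    show "\<exists>u. ok u \<and> ((0::nat) = 0 \<longrightarrow> u = (a, b, c))"
      using a b c eq by (auto simp: ok_def)
    show "\<exists>v. (ok v \<and> (Suc n = 0 \<longrightarrow> v = (a, b, c))) \<and> link u v"
      if "ok u \<and> (n = 0 \<longrightarrow> u = (a, b, c))" for u n
      using step[of u] that by auto
  qed
  then obtain u where u: "\<And>n. ok (u n)" "u 0 = (a, b, c)" "\<And>n. link (u n) (u (Suc n))"
    by metis
  define p x y where "p = (\<lambda>n. fst (u n))" and "x = (\<lambda>n. fst (snd (u n)))"
    and "y = (\<lambda>n. snd (snd (u n)))"
  have u_eq: "u n = (p n, x n, y n)" for n
    by (simp add: p_def x_def y_def)
  have 0: "p 0 = a" "x 0 = b" "y 0 = c"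
    using u(2) by (simp_all add: p_def x_def y_def)
  have closed [simp]: "p n \<in> carrier T" "x n \<in> carrier T" "y n \<in> carrier T" for n
    using u(1)[of n] by (simp_all add: u_eq ok_def)
  have p: "p n = x (Suc n) \<otimes> p (Suc n)" "p n = y (Suc n) \<otimes> p (Suc n)" for n
    using u(3)[of n] unfolding u_eq link_def prod.case by blast+
  have "\<forall>n. \<exists>s. s \<in> carrier T \<and> x n = s \<otimes> x (Suc n) \<and> y n = s \<otimes> y (Suc n)"
    using u(3) unfolding u_eq link_def prod.case by blast
  from choice[OF this] obtain s
    where s_all: "\<forall>n. s n \<in> carrier T \<and> x n = s n \<otimes> x (Suc n) \<and> y n = s n \<otimes> y (Suc n)" ..
  have s [simp]: "s n \<in> carrier T" and x: "x n = s n \<otimes> x (Suc n)"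
    and y: "y n = s n \<otimes> y (Suc n)" for n
    by (fact spec[OF s_all, of n, THEN conjunct1]
        spec[OF s_all, of n, THEN conjunct2, THEN conjunct1]
        spec[OF s_all, of n, THEN conjunct2, THEN conjunct2])+
  have absorbed: "a \<otimes> omega d = a"
    if d: "d \<in> carrier T" and w: "\<And>n. w n \<in> carrier T" "\<And>n. p n = w (Suc n) \<otimes> p (Suc n)"
      "\<And>n. w n = d \<otimes> Sum (\<lambda>i. s (n + i))" for d w
  proof -
    \<comment> \<open>The sequence \<open>p\<close>, which starts with \<open>a\<close>, loses all the \<open>w (Suc n)\<close> one after the other.\<close>
    have "\<exists>k \<in> carrier T. \<forall>n. p n = k \<otimes> Sum (\<lambda>i. w (Suc (n + i)))"
      by (rule remainder[of p "\<lambda>n. w (Suc n)", OF closed(1) w(1,2)])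
    then obtain k where k: "k \<in> carrier T" "p 0 = k \<otimes> Sum (\<lambda>i. w (Suc (0 + i)))"
      by blast
    have "omega d \<preceq> Sum (\<lambda>i. w (Suc i))"
      using d by (intro Sum_mono, simp, unfold w(3)) simp_all
    moreover have "Sum (\<lambda>i. w (Suc i)) \<preceq> a"
      using k 0(1) w(1) by (intro belowI[of k]) (auto simp: m_comm)
    ultimately have "omega d \<preceq> a"
      by (rule below_trans[rotated]) (simp add: d)
    then show ?thesis
      by (rule idempotent_below_absorbed[OF omega_idempotent[OF d]])
  qed
  obtain v where v: "v \<in> carrier T" "\<And>n. x n = v \<otimes> Sum (\<lambda>i. s (n + i))"
    using remainder[of x s, OF closed(2) s x] by blast
  obtain w where w: "w \<in> carrier T" "\<And>n. y n = w \<otimes> Sum (\<lambda>i. s (n + i))"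
    using remainder[of y s, OF closed(3) s y] by blast
  have abs: "a \<otimes> omega v = a" "a \<otimes> omega w = a"
    using absorbed[OF v(1) closed(2) p(1) v(2)] absorbed[OF w(1) closed(3) p(2) w(2)] by blast+
  define z where "z = omega v \<otimes> omega w"
  have oc: "omega v \<in> carrier T" "omega w \<in> carrier T" "Sum s \<in> carrier T"
    using v w by auto
  have bc: "b = v \<otimes> Sum s" "c = w \<otimes> Sum s"
    using v(2)[of 0] w(2)[of 0] unfolding 0 by simp_all
  have "b \<otimes> z = Sum s \<otimes> (v \<otimes> omega v) \<otimes> omega w"
    using oc v w by (simp add: bc z_def m_ac)
  also have "\<dots> = Sum s \<otimes> omega v \<otimes> (w \<otimes> omega w)"
    using v w by (simp add: mult_omega_self)
  also have "\<dots> = c \<otimes> z"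
    using oc v w by (simp add: bc z_def m_ac)
  finally have "b \<otimes> z = c \<otimes> z" .
  moreover have "a \<otimes> z = a"
    using abs oc a by (simp add: z_def m_assoc[symmetric])
  moreover have "z \<in> idempotents T"
    unfolding z_def using v w by (intro idempotent_mult omega_idempotent)
  ultimately show thesis by (intro that)
qed

lemma finprod_atMost_below_Sum:
  assumes "\<And>n. a n \<in> carrier T"
  shows "finprod T a {..n} \<preceq> Sum a"
  using assms
proof (induction n arbitrary: a)
  case 0
  then show ?case
    using Sum_unfold[of a] by auto
next
  case (Suc n)
  have "finprod T (\<lambda>i. a (Suc i)) {..n} \<otimes> a 0 \<preceq> Sum (\<lambda>i. a (Suc i)) \<otimes> a 0"
    using Suc by (intro below_mult) (auto intro: finprod_closed)
  then show ?case
    using Suc.prems Sum_unfold[of a] by (simp add: finprod_Suc2 m_comm del: finprod_Suc)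
qed

text \<open>For every \<open>n\<close> there is a complement of \<open>a\<^sub>0\<close> in \<open>c\<close> that is above the next \<open>n\<close> terms, but it depends on
  \<open>n\<close>. By the cancellation law any two of these complements agree up to an idempotent absorbed by
  \<open>a\<^sub>0\<close>; adding all these idempotents to one complement makes it work for every \<open>n\<close>.\<close>

lemma split_first_summand:
  assumes a: "\<And>n. a n \<in> carrier T" and c: "c \<in> carrier T"
    and bound: "\<And>n. finprod T a {..n} \<preceq> c"
  shows "\<exists>c' \<in> carrier T. c = a 0 \<otimes> c' \<and> (\<forall>n. finprod T (\<lambda>i. a (Suc i)) {..n} \<preceq> c')"
proof -
  define tail where "tail n = finprod T (\<lambda>i. a (Suc i)) {..n}" for n
  have tail [simp]: "tail n \<in> carrier T" for n
    using a by (auto simp: tail_def)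
  have "\<exists>r \<in> carrier T. c = a 0 \<otimes> r \<and> tail n \<preceq> r" for n
  proof -
    have "finprod T a {..Suc n} = tail n \<otimes> a 0"
      using a by (auto simp: tail_def finprod_Suc2 simp del: finprod_Suc)
    then obtain k where "k \<in> carrier T" "tail n \<otimes> a 0 \<otimes> k = c"
      using bound[of "Suc n"] by (auto simp: below_iff)
    then show ?thesis
      using a by (intro bexI[of _ "tail n \<otimes> k"]) (auto simp: m_ac)
  qed
  then obtain r where r [simp]: "\<And>n. r n \<in> carrier T" and rc: "\<And>n. c = a 0 \<otimes> r n"
    and rt: "\<And>n. tail n \<preceq> r n"
    by metis
  have "\<exists>z. z \<in> idempotents T \<and> a 0 \<otimes> z = a 0 \<and> r 0 \<otimes> z = r n \<otimes> z" for n
    using cancel_modulo_absorbed[of "a 0" "r 0" "r n"] a rc by (metis r)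
  then obtain z where z: "\<And>n. z n \<in> idempotents T" "\<And>n. a 0 \<otimes> z n = a 0"
    "\<And>n. r 0 \<otimes> z n = r n \<otimes> z n"
    by metis
  have zc [simp]: "z n \<in> carrier T" for n
    using z(1) by (auto simp: idempotents_def)
  define c' where "c' = r 0 \<otimes> Sum z"
  have abs: "a 0 \<otimes> Sum z = a 0" and Z: "Sum z \<in> idempotents T"
    using absorb_Sum_idempotents[of "a 0" z] a z by auto
  have "c = a 0 \<otimes> Sum z \<otimes> r 0"
    using abs rc[of 0] by simp
  also have "\<dots> = a 0 \<otimes> c'"
    using a by (simp add: c'_def m_ac)
  finally have "c = a 0 \<otimes> c'" .
  moreover have "tail n \<preceq> c'" for n
  proof -
    have "z n \<preceq> Sum z"
    proof -
      have "finprod T z {..n} = z n \<otimes> finprod T z {..<n}"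
        by (rule finprod_Suc3) simp
      moreover have "finprod T z {..<n} \<in> carrier T"
        by (rule finprod_closed) simp
      ultimately have "z n \<preceq> finprod T z {..n}"
        by simp
      then show ?thesis
        using finprod_atMost_below_Sum[of z n] below_trans zc by blast
    qed
    then have "c' = r 0 \<otimes> (Sum z \<otimes> z n)"
      using idempotent_below_absorbed[OF z(1)] by (simp add: c'_def)
    also have "\<dots> = r 0 \<otimes> z n \<otimes> Sum z"
      by (simp add: m_ac)
    also have "\<dots> = r n \<otimes> (z n \<otimes> Sum z)"
      by (simp add: z(3) m_ac)
    finally have "r n \<preceq> c'"
      by simp
    then show ?thesis
      using rt below_trans tail by blast
  qed
  moreover have "c' \<in> carrier T"
    by (auto simp: c'_def)
  ultimately show ?thesis
    unfolding tail_def by blast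
qed

text \<open>Splitting off one summand after the other produces a sequence to which the remainder postulate
  applies.\<close>

lemma Sum_below:
  assumes a: "\<And>n. a n \<in> carrier T" and c: "c \<in> carrier T"
    and bound: "\<And>n. finprod T a {..n} \<preceq> c"
  shows "Sum a \<preceq> c"
proof -
  define ok where "ok n k \<longleftrightarrow> k \<in> carrier T \<and> (\<forall>m. finprod T (\<lambda>i. a (n + i)) {..m} \<preceq> k)" for n k
  have "\<exists>k. \<forall>n. (ok n (k n) \<and> (n = 0 \<longrightarrow> k n = c)) \<and> k n = a n \<otimes> k (Suc n)"
  proof (rule dependent_nat_choice)
    show "\<exists>k. ok 0 k \<and> ((0::nat) = 0 \<longrightarrow> k = c)"
      using c bound by (auto simp: ok_def)
    fix k n
    assume k: "ok n k \<and> (n = 0 \<longrightarrow> k = c)"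
    have "\<exists>k' \<in> carrier T. k = a (n + 0) \<otimes> k' \<and>
        (\<forall>m. finprod T (\<lambda>i. a (n + Suc i)) {..m} \<preceq> k')"
      using k by (intro split_first_summand a) (simp_all add: ok_def)
    then show "\<exists>k'. (ok (Suc n) k' \<and> (Suc n = 0 \<longrightarrow> k' = c)) \<and> k = a n \<otimes> k'"
      by (auto simp: ok_def)
  qed
  then obtain k
    where k_all: "\<forall>n. (ok n (k n) \<and> (n = 0 \<longrightarrow> k n = c)) \<and> k n = a n \<otimes> k (Suc n)" ..
  have ok: "ok n (k n)" and k_Suc: "k n = a n \<otimes> k (Suc n)" for n
    by (fact spec[OF k_all, of n, THEN conjunct1, THEN conjunct1]
        spec[OF k_all, of n, THEN conjunct2])+
  have k_0: "k 0 = c"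
    using spec[OF k_all, of 0, THEN conjunct1] by simp
  have k [simp]: "k n \<in> carrier T" for n
    using ok[of n] by (simp add: ok_def)
  obtain d where d: "d \<in> carrier T" "\<forall>n. k n = d \<otimes> Sum (\<lambda>i. a (n + i))"
    using remainder[of k a, OF k a k_Suc] ..
  have "c = d \<otimes> Sum a"
    using spec[OF d(2), of 0] by (simp add: k_0)
  then show ?thesis
    using a d(1) by simp
qed

lemma Sum_is_lub:
  assumes a: "\<And>n. a n \<in> carrier T"
  shows "is_lub (alg_order T) (Sum a) (range (\<lambda>n. finprod T a {..n}))"
proof -
  have "Sum a \<in> Upper (alg_order T) (range (\<lambda>n. finprod T a {..n}))"
    using finprod_atMost_below_Sum[of a] a
    by (intro Upper_memI) (auto simp: alg_order_def)
  moreover have "Sum a \<preceq> c" if "c \<in> Upper (alg_order T) (range (\<lambda>n. finprod T a {..n}))" for c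
  proof (rule Sum_below[OF a])
    show "c \<in> carrier T"
      using that by (simp add: Upper_def alg_order_def)
    fix n
    have "finprod T a {..n} \<in> carrier T"
      using a by auto
    then show "finprod T a {..n} \<preceq> c"
      using that by (auto simp: Upper_def alg_order_def)
  qed
  ultimately show ?thesis
    using a by (auto simp: least_def Upper_def alg_order_def)
qed

lemma isotropy_maximal:
  assumes "x \<in> isotropy_monoid T e" "f \<in> idempotents T" "e \<preceq> f" "f \<preceq> x"
  shows "f = e"
  using assms unfolding isotropy_monoid_def up_set_def by blast

text \<open>As \<open>x\<close> absorbs the idempotent \<open>z\<close> of the cancellation law, \<open>e + z\<close> is still below \<open>x\<close>. Maximality of
  \<open>e\<close> among the idempotents below \<open>x\<close> gives \<open>e + z = e\<close>, so adding \<open>e\<close> includes adding \<open>z\<close>.\<close>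

lemma isotropy_cancel:
  assumes e: "e \<in> idempotents T" and x: "x \<in> isotropy_monoid T e"
    and b: "b \<in> carrier T" and c: "c \<in> carrier T" and eq: "x \<otimes> b = x \<otimes> c"
  shows "b \<otimes> e = c \<otimes> e"
proof -
  have xc: "x \<in> carrier T" and ex: "e \<preceq> x"
    using x by (auto simp: isotropy_monoid_def up_set_def)
  obtain z where z: "z \<in> idempotents T" "x \<otimes> z = x" "b \<otimes> z = c \<otimes> z"
    using cancel_modulo_absorbed[OF xc b c eq] by blast
  have ezc: "e \<in> carrier T" "z \<in> carrier T"
    using e z by (auto simp: idempotents_def)
  have "e \<otimes> z \<preceq> x \<otimes> z"
    using ezc ex by (intro below_mult) auto
  then have "e \<otimes> z = e"
    using isotropy_maximal[OF x idempotent_mult[OF e z(1)]] ezc z(2) by simp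
  then have "b \<otimes> e = b \<otimes> z \<otimes> e" "c \<otimes> e = c \<otimes> z \<otimes> e"
    using b c ezc by (auto simp: m_ac)
  then show ?thesis
    using z(3) by simp
qed

lemma isotropy_below:
  assumes e: "e \<in> idempotents T" and x: "x \<in> isotropy_monoid T e"
    and y: "y \<in> carrier T" "e \<preceq> y" "y \<preceq> x"
  shows "y \<in> isotropy_monoid T e"
proof -
  have "f = e" if "f \<in> idempotents T" "e \<preceq> f" "f \<preceq> y" for f
    using that isotropy_maximal[OF x] below_trans[of f y x] y by (auto simp: idempotents_def)
  then show ?thesis
    using y unfolding isotropy_monoid_def up_set_def by blast
qed

text \<open>The abstract form of continuity from above. To see that a lower bound \<open>c\<close> is at most \<open>a + e\<close>, put \<open>c\<close> in
  front of the series \<open>d\<^sub>N + d\<^sub>N\<^sub>+\<^sub>1 + \<dots>\<close>: its finite partial sums lie below \<open>x N\<close> because \<open>c\<close> lies below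
  the remaining tail. So does its sum, and the series is then cancelled from both sides inside the
  isotropy monoid.\<close>

lemma Sum_tails_is_glb:
  assumes a: "a \<in> carrier T" and d: "\<And>n. d n \<in> carrier T" and e: "e \<in> idempotents T"
    and iso: "\<And>n. n \<ge> N \<Longrightarrow> a \<otimes> Sum (\<lambda>i. d (n + i)) \<in> isotropy_monoid T e"
  shows "is_glb (alg_order T) (a \<otimes> e) (range (\<lambda>n. a \<otimes> Sum (\<lambda>i. d (n + i))))"
proof -
  define x where "x n = a \<otimes> Sum (\<lambda>i. d (n + i))" for n
  have ec [simp]: "e \<in> carrier T"
    using e by (simp add: idempotents_def)
  have tc [simp]: "Sum (\<lambda>i. d (n + i)) \<in> carrier T" for n
    using d by auto
  have xc [simp]: "x n \<in> carrier T" for n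
    using a by (simp add: x_def)
  have x_Suc: "x n = d n \<otimes> x (Suc n)" for n
    using Sum_unfold[of "\<lambda>i. d (n + i)"] d a tc[of "Suc n"]
    by (simp add: x_def m_ac)
  have x_antimono: "x (n + k) \<preceq> x n" for n k
  proof (induction k)
    case 0
    then show ?case by simp
  next
    case (Suc k)
    have "x (n + Suc k) \<preceq> x (n + k)"
      using x_Suc[of "n + k"] d by (intro belowI[of "d (n + k)"]) (auto simp: m_comm)
    then show ?case
      by (rule below_trans[OF xc _ Suc.IH])
  qed
  have e_below: "e \<preceq> x n" if "n \<ge> N" for n
    using iso[OF that] by (simp add: x_def isotropy_monoid_def up_set_def)
  have lower: "a \<otimes> e \<preceq> x n" for n
  proof -
    have "x (n + N) \<otimes> e = a \<otimes> e \<otimes> Sum (\<lambda>i. d (n + N + i))"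
      using a tc[of "n + N"] by (simp add: x_def m_ac)
    then have "a \<otimes> e \<preceq> x (n + N)"
      using idempotent_below_absorbed[OF e e_below[of "n + N"]] by simp
    then show ?thesis
      by (rule below_trans[rotated, OF _ x_antimono]) (simp add: a)
  qed
  have greatest: "c \<preceq> a \<otimes> e" if c: "c \<in> carrier T" and cx: "\<And>n. c \<preceq> x n" for c
  proof -
    define s where "s = (\<lambda>i. case i of 0 \<Rightarrow> c | Suc i \<Rightarrow> d (N + i))"
    have sc: "s i \<in> carrier T" for i
      using c d by (auto simp: s_def split: nat.split)
    have partial: "finprod T (\<lambda>i. d (N + i)) {..<n} \<otimes> x (N + n) = x N" for n
    proof (induction n)
      case (Suc n)
      have "finprod T (\<lambda>i. d (N + i)) {..<Suc n} = d (N + n) \<otimes> finprod T (\<lambda>i. d (N + i)) {..<n}"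
        using d by (simp add: lessThan_Suc Pi_def)
      then show ?case
        using Suc x_Suc[of "N + n"] d by (simp add: m_ac Pi_def)
    qed simp
    have "finprod T s {..n} \<preceq> x N" for n
    proof -
      have "finprod T s {..n} = finprod T (\<lambda>i. d (N + i)) {..<n} \<otimes> c"
      proof (cases n)
        case 0
        then show ?thesis using sc c by (simp add: s_def)
      next
        case (Suc m)
        have "finprod T s {..Suc m} = finprod T (\<lambda>i. s (Suc i)) {..m} \<otimes> s 0"
          using sc by (intro finprod_Suc2) auto
        then show ?thesis
          by (simp add: s_def Suc lessThan_Suc_atMost)
      qed
      moreover have "finprod T (\<lambda>i. d (N + i)) {..<n} \<otimes> c \<preceq>
          finprod T (\<lambda>i. d (N + i)) {..<n} \<otimes> x (N + n)"
        using c d cx by (intro below_mult) (auto intro: finprod_closed)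
      ultimately show ?thesis
        using partial by simp
    qed
    then have "Sum s \<preceq> x N"
      by (intro Sum_below sc) auto
    moreover have "Sum s = c \<otimes> Sum (\<lambda>i. d (N + i))"
      using Sum_unfold[of s] sc by (simp add: s_def)
    ultimately obtain r where r: "r \<in> carrier T" and
      eq: "c \<otimes> Sum (\<lambda>i. d (N + i)) \<otimes> r = a \<otimes> Sum (\<lambda>i. d (N + i))"
      by (auto simp: below_iff x_def)
    \<comment> \<open>The series alone need not be above \<open>e\<close>; after adding \<open>e\<close> it lies in the isotropy monoid and cancels.\<close>
    define y where "y = Sum (\<lambda>i. d (N + i)) \<otimes> e"
    have yc: "y \<in> carrier T"
      by (simp add: y_def)
    have "x N \<otimes> e = y \<otimes> a"
      using a by (simp add: x_def y_def m_ac)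
    then have "x N = y \<otimes> a"
      using idempotent_below_absorbed[OF e e_below[of N]] by simp
    then have "y \<preceq> x N"
      using a by simp
    moreover have "e \<preceq> y"
      by (simp add: y_def)
    moreover have "x N \<in> isotropy_monoid T e"
      using iso[of N] by (simp add: x_def)
    ultimately have "y \<in> isotropy_monoid T e"
      using isotropy_below[OF e] yc by blast
    moreover have "y \<otimes> a = y \<otimes> (c \<otimes> r)"
    proof -
      have "y \<otimes> a = e \<otimes> (a \<otimes> Sum (\<lambda>i. d (N + i)))"
        using a by (simp add: y_def m_ac)
      also have "\<dots> = y \<otimes> (c \<otimes> r)"
        using c r by (simp add: y_def m_ac flip: eq)
      finally show ?thesis .
    qed
    ultimately have "a \<otimes> e = c \<otimes> r \<otimes> e"
      using isotropy_cancel[OF e _ a m_closed[OF c r]] by blast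
    then show ?thesis
      using c r by (intro belowI[of "r \<otimes> e"]) (auto simp: m_assoc)
  qed
  have "is_glb (alg_order T) (a \<otimes> e) (range x)"
  proof (unfold greatest_def, intro conjI ballI)
    show "a \<otimes> e \<in> Lower (alg_order T) (range x)"
      using lower a by (intro Lower_memI) (auto simp: alg_order_def)
    show "Lower (alg_order T) (range x) \<subseteq> carrier (alg_order T)"
      by simp
    fix c assume "c \<in> Lower (alg_order T) (range x)"
    then show "c \<preceq> a \<otimes> e"
      using xc by (intro greatest) (auto simp: Lower_def alg_order_def)
  qed
  then show ?thesis
    by (simp add: x_def[abs_def])
qed

end

section \<open>Coproducts as integer-valued functions\<close>

definition tally :: "'x family \<Rightarrow> 'x \<Rightarrow> ennreal" where
  "tally P x = (\<Sum>j. indicator (P j) x)"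

text \<open>For \<open>x \<in> P j\<close> this is the position of \<open>j\<close> among the indices of the members that contain \<open>x\<close>. It serves
  to match two coproducts that cover each point equally often.\<close>

definition hits :: "'x family \<Rightarrow> nat \<Rightarrow> 'x \<Rightarrow> nat" where
  "hits P j x = card {i. i < j \<and> x \<in> P i}"

text \<open>These are the multiplicity functions of families (\<open>tally_in_counting\<close>, \<open>counting_eq_tally\<close>). The
  condition outside the space makes a function unique for the coproduct that it describes.\<close>

definition counting :: "'x measure \<Rightarrow> ('x \<Rightarrow> ennreal) set" where
  "counting M = {f \<in> borel_measurable M. (\<forall>x. f x \<in> range ennreal_of_enat) \<and>
     (\<forall>x. x \<notin> space M \<longrightarrow> f x = 0)}"

lemma hits_0: "hits P 0 x = 0"
  by (simp add: hits_def)

lemma hits_Suc: "hits P (Suc j) x = hits P j x + (if x \<in> P j then 1 else 0)"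
proof -
  have "{i. i < Suc j \<and> x \<in> P i} = {i. i < j \<and> x \<in> P i} \<union> (if x \<in> P j then {j} else {})"
    by (auto simp: less_Suc_eq)
  then show ?thesis
    by (simp add: hits_def)
qed

lemma hits_less:
  assumes "x \<in> P i" "i < j"
  shows "hits P i x < hits P j x"
proof -
  have "mono (\<lambda>j. hits P j x)"
    by (intro incseq_SucI) (simp add: hits_Suc)
  then have "hits P (Suc i) x \<le> hits P j x"
    using assms(2) by (simp add: monoD[of "\<lambda>j. hits P j x"])
  then show ?thesis
    using assms(1) by (simp add: hits_Suc)
qed

lemma sum_indicator_eq_hits: "(\<Sum>i<j. indicator (P i) x :: ennreal) = of_nat (hits P j x)"
  by (induction j) (simp_all add: hits_0 hits_Suc)

lemma tally_eq_SUP_hits: "tally P x = (SUP j. of_nat (hits P j x))"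
  unfolding tally_def by (subst suminf_eq_SUP) (simp add: sum_indicator_eq_hits)

text \<open>The members containing a given point are numbered by \<open>hits\<close> without gaps, starting from zero.\<close>

lemma less_tally_iff: "of_nat n < tally P x \<longleftrightarrow> (\<exists>j. x \<in> P j \<and> hits P j x = n)"
proof
  assume "of_nat n < tally P x"
  then have ex: "\<exists>j. n < hits P j x"
    by (auto simp: tally_eq_SUP_hits less_SUP_iff)
  define j where "j = (LEAST j. n < hits P j x)"
  have j: "n < hits P j x"
    unfolding j_def using ex by (rule LeastI_ex)
  then obtain i where i: "j = Suc i"
    by (cases j) (auto simp: hits_0)
  then have "\<not> n < hits P i x"
    unfolding j_def using not_less_Least by (metis lessI)
  then show "\<exists>j. x \<in> P j \<and> hits P j x = n"
    using j by (auto simp: i hits_Suc split: if_splits)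
next
  assume "\<exists>j. x \<in> P j \<and> hits P j x = n"
  then obtain j where "x \<in> P j" "hits P j x = n" by blast
  then have "n < hits P (Suc j) x"
    by (simp add: hits_Suc)
  then show "of_nat n < tally P x"
    by (auto simp: tally_eq_SUP_hits less_SUP_iff)
qed

lemma tally_in_counting:
  assumes "P \<in> families M"
  shows "tally P \<in> counting M"
proof -
  have [measurable]: "P j \<in> sets M" for j
    using assms by (simp add: families_def)
  have "tally P \<in> borel_measurable M"
    unfolding tally_def[abs_def] by measurable
  moreover have "tally P x = ennreal_of_enat (SUP j. enat (hits P j x))" for x
    by (simp add: tally_eq_SUP_hits ennreal_of_enat_Sup image_image)
  moreover have "tally P x = 0" if "x \<notin> space M" for x
  proof -
    have "x \<notin> P j" for j
      using that sets.sets_into_space[of "P j" M] by auto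
    then show ?thesis
      by (simp add: tally_def)
  qed
  ultimately show ?thesis
    by (auto simp: counting_def)
qed

text \<open>An integer-valued function is the sum of the indicators of its superlevel sets.\<close>

lemma counting_eq_tally:
  assumes "f \<in> counting M"
  obtains P where "P \<in> families M" "tally P = f"
proof
  have [measurable]: "f \<in> borel_measurable M"
    using assms by (simp add: counting_def)
  define P where "P n = {x \<in> space M. of_nat n < f x}" for n :: nat
  have "P n \<in> sets M" for n
    unfolding P_def by measurable
  then show "P \<in> families M"
    by (simp add: families_def)
  show "tally P = f"
  proof
    fix x
    obtain k where k: "f x = ennreal_of_enat k"
      using assms by (auto simp: counting_def)
    have P: "x \<in> P n \<longleftrightarrow> enat n < k" for n
    proof (cases "x \<in> space M")
      case True
      then show ?thesis
        by (cases k) (simp_all add: P_def k of_nat_less_top)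
    next
      case False
      then have "k = 0"
        using assms k by (metis (mono_tags, lifting) counting_def ennreal_of_enat_0 ennreal_of_enat_inj mem_Collect_eq)
      then show ?thesis
        using False by (simp add: P_def)
    qed
    have "hits P j x = (case k of enat m \<Rightarrow> min m j | \<infinity> \<Rightarrow> j)" for j
    proof (induction j)
      case 0
      then show ?case by (simp add: hits_0 split: enat.split)
    next
      case (Suc j)
      then show ?case by (simp add: hits_Suc P split: enat.split)
    qed
    then have hits: "tally P x = (SUP j. of_nat (case k of enat m \<Rightarrow> min m j | \<infinity> \<Rightarrow> j))"
      by (simp add: tally_eq_SUP_hits)
    show "tally P x = f x"
    proof (cases k)
      case (enat m)
      have "(SUP j. of_nat (min m j) :: ennreal) = of_nat m"
        by (rule antisym) (auto intro!: SUP_least SUP_upper2[of m])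
      then show ?thesis
        by (simp add: hits k enat)
    next
      case infinity
      then show ?thesis
        by (simp add: hits k ennreal_SUP_of_nat_eq_top)
    qed
  qed
qed

lemma Coprod_in_families: "(\<And>i. P i \<in> families M) \<Longrightarrow> Coprod P \<in> families M"
  by (auto simp: families_def Coprod_def split: prod.split)

lemma tally_Coprod: "tally (Coprod P) x = (\<Sum>i. tally (P i) x)"
proof -
  have "tally (Coprod P) x = (\<Sum>n. case prod_decode n of (i, j) \<Rightarrow> indicator (P i j) x)"
    by (auto simp: tally_def Coprod_def intro!: suminf_cong split: prod.split)
  also have "\<dots> = (\<Sum>i. tally (P i) x)"
    by (rule suminf_ennreal_2dimen) (simp add: tally_def)
  finally show ?thesis .
qed

lemma suminf_ennreal_swap:
  fixes f :: "nat \<Rightarrow> nat \<Rightarrow> ennreal"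
  shows "(\<Sum>i. \<Sum>j. f i j) = (\<Sum>j. \<Sum>i. f i j)"
  using nn_integral_suminf[of "\<lambda>i j. f i j" "count_space UNIV"]
  by (simp add: nn_integral_count_space_nat)

text \<open>If the multiplicities agree, then at every point the \<open>n\<close>-th member of \<open>P\<close> containing it can be matched
  with the \<open>n\<close>-th member of \<open>Q\<close> containing it. Only finitely many earlier members are counted, so the
  matching is measurable, also at points of infinite multiplicity.\<close>

lemma coprod_eq_iff_tally:
  assumes P: "P \<in> families M" and Q: "Q \<in> families M"
  shows "coprod_eq M P Q \<longleftrightarrow> tally P = tally Q"
proof
  assume "coprod_eq M P Q"
  then obtain R where R: "\<forall>j. disjoint_family (\<lambda>k. R j k) \<and> P j = (\<Union>k. R j k)"
    "\<forall>k. disjoint_family (\<lambda>j. R j k) \<and> Q k = (\<Union>j. R j k)"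
    unfolding coprod_eq_def by (elim exE conjE)
  show "tally P = tally Q"
  proof
    fix x
    have "tally P x = (\<Sum>j. \<Sum>k. indicator (R j k) x)"
      unfolding tally_def using R(1) by (intro suminf_cong) (metis suminf_indicator)
    also have "\<dots> = (\<Sum>k. \<Sum>j. indicator (R j k) x)"
      by (rule suminf_ennreal_swap)
    also have "\<dots> = tally Q x"
      unfolding tally_def using R(2) by (intro suminf_cong) (metis suminf_indicator)
    finally show "tally P x = tally Q x" .
  qed
next
  assume eq: "tally P = tally Q"
  define R where "R j k = {x \<in> P j \<inter> Q k. hits P j x = hits Q k x}" for j k
  have [measurable]: "P j \<in> sets M" "Q j \<in> sets M" for j
    using P Q by (simp_all add: families_def)
  have "R j k \<in> sets M" for j k
  proof -
    have "R j k = {x \<in> space M. x \<in> P j \<and> x \<in> Q k \<and>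
        (\<Sum>i<j. indicator (P i) x :: ennreal) = (\<Sum>i<k. indicator (Q i) x)}"
      using sets.sets_into_space[of "P j" M] by (auto simp: R_def sum_indicator_eq_hits)
    also have "\<dots> \<in> sets M"
      by measurable
    finally show ?thesis .
  qed
  moreover have "disjoint_family (\<lambda>k. R j k)" for j
    unfolding disjoint_family_on_def R_def by (auto, metis linorder_neq_iff less_irrefl hits_less)
  moreover have "disjoint_family (\<lambda>j. R j k)" for k
    unfolding disjoint_family_on_def R_def by (auto, metis linorder_neq_iff less_irrefl hits_less)
  moreover have "P j = (\<Union>k. R j k)" for j
    using less_tally_iff[of _ P] less_tally_iff[of _ Q] eq by (auto simp: R_def) metis
  moreover have "Q k = (\<Union>j. R j k)" for k
    using less_tally_iff[of _ P] less_tally_iff[of _ Q] eq by (auto simp: R_def) metis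
  ultimately show "coprod_eq M P Q"
    unfolding coprod_eq_def by (intro exI[of _ R]) auto
qed

lemma counting_measurable [measurable_dest]: "f \<in> counting M \<Longrightarrow> f \<in> borel_measurable M"
  by (simp add: counting_def)

lemma countingI:
  "f \<in> borel_measurable M \<Longrightarrow> (\<And>x. f x \<in> range ennreal_of_enat) \<Longrightarrow>
    (\<And>x. x \<notin> space M \<Longrightarrow> f x = 0) \<Longrightarrow> f \<in> counting M"
  by (simp add: counting_def)

lemma counting_outside: "f \<in> counting M \<Longrightarrow> x \<notin> space M \<Longrightarrow> f x = 0"
  by (simp add: counting_def)

lemma counting_zero: "(\<lambda>_. 0) \<in> counting M"
  by (auto simp: counting_def intro: range_eqI[of _ _ 0])

lemma counting_value:
  assumes "f \<in> counting M"
  shows "\<exists>k. f x = ennreal_of_enat k"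
proof -
  have "f x \<in> range ennreal_of_enat"
    using assms by (simp add: counting_def)
  then show ?thesis by auto
qed

lemma counting_add:
  assumes "f \<in> counting M" "g \<in> counting M"
  shows "(\<lambda>x. f x + g x) \<in> counting M"
proof -
  have "f x + g x \<in> range ennreal_of_enat" for x
  proof -
    obtain k l where "f x = ennreal_of_enat k" "g x = ennreal_of_enat l"
      using assms counting_value by metis
    then have "f x + g x = ennreal_of_enat (k + l)"
      by simp
    then show ?thesis by blast
  qed
  moreover have "(\<lambda>x. f x + g x) \<in> borel_measurable M"
    using assms by measurable
  ultimately show ?thesis
    by (intro countingI) (simp_all add: counting_outside[OF assms(1)] counting_outside[OF assms(2)])
qed

lemma counting_suminf:
  assumes "\<And>i. f i \<in> counting M"
  shows "(\<lambda>x. \<Sum>i. f i x) \<in> counting M"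
proof -
  have "\<forall>i. \<exists>P. P \<in> families M \<and> tally P = f i"
    using assms by (meson counting_eq_tally)
  from choice[OF this] obtain P where "\<forall>i. P i \<in> families M \<and> tally (P i) = f i" ..
  then have "Coprod P \<in> families M" "tally (Coprod P) = (\<lambda>x. \<Sum>i. f i x)"
    by (auto intro: Coprod_in_families simp: tally_Coprod)
  then show ?thesis
    using tally_in_counting by metis
qed

lemma counting_if:
  assumes "f \<in> counting M" "g \<in> counting M" "Measurable.pred M Q"
  shows "(\<lambda>x. if Q x then f x else g x) \<in> counting M"
proof -
  have "(\<lambda>x. if Q x then f x else g x) \<in> borel_measurable M"
    using assms by measurable
  then show ?thesis
    using assms(1,2) by (simp add: counting_def)
qed

lemma counting_indicator: "A \<in> sets M \<Longrightarrow> indicator A \<in> counting M"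
  using sets.sets_into_space[of A M]
  by (auto simp: counting_def indicator_def intro: range_eqI[of _ _ 0] range_eqI[of _ _ 1])

text \<open>A set of extended natural numbers has a least element, so the infimum is one of the values.\<close>

lemma counting_INF:
  assumes "\<And>n :: nat. f n \<in> counting M"
  shows "(\<lambda>x. INF n. f n x) \<in> counting M"
proof -
  have "(INF n. f n x) \<in> range ennreal_of_enat" for x
  proof -
    have "\<forall>n. \<exists>k. f n x = ennreal_of_enat k"
      using assms by (blast intro: counting_value)
    from choice[OF this] obtain k where k: "\<And>n. f n x = ennreal_of_enat (k n)"
      by blast
    obtain n where n: "k n = (LEAST l. l \<in> range k)"
      using LeastI[of "\<lambda>l. l \<in> range k" "k 0"] by (metis rangeE rangeI)
    then have "k n \<le> k m" for m
      by (simp add: Least_le)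
    then have "(INF n. f n x) = ennreal_of_enat (k n)"
      by (intro antisym INF_lower2[of n] INF_greatest) (simp_all add: k)
    then show ?thesis by blast
  qed
  moreover have "(\<lambda>x. INF n. f n x) \<in> borel_measurable M"
    using assms by measurable
  ultimately show ?thesis
    by (intro countingI) (simp_all add: counting_outside[OF assms])
qed

text \<open>The refinement is found on families: the sets relating the two equal coproducts are grouped
  according to the summands from which they stem.\<close>

lemma counting_refinement:
  assumes f: "\<And>i. f i \<in> counting M" and g: "\<And>j. g j \<in> counting M"
    and eq: "\<And>x. (\<Sum>i. f i x) = (\<Sum>j. g j x)"
  obtains h where "\<And>i j. h i j \<in> counting M" "\<And>i x. f i x = (\<Sum>j. h i j x)"
    "\<And>j x. g j x = (\<Sum>i. h i j x)"
proof -
  have "\<forall>i. \<exists>P. P \<in> families M \<and> tally P = f i" "\<forall>i. \<exists>P. P \<in> families M \<and> tally P = g i"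
    using f g by (meson counting_eq_tally)+
  from this[THEN choice] obtain P Q where
    P: "\<And>i. P i \<in> families M" "\<And>i. tally (P i) = f i" and
    Q: "\<And>i. Q i \<in> families M" "\<And>i. tally (Q i) = g i"
    by blast
  have "coprod_eq M (Coprod P) (Coprod Q)"
    using P Q eq by (simp add: coprod_eq_iff_tally Coprod_in_families tally_Coprod fun_eq_iff)
  then obtain R where R: "\<forall>j k. R j k \<in> sets M"
    "\<forall>j. disjoint_family (\<lambda>k. R j k) \<and> Coprod P j = (\<Union>k. R j k)"
    "\<forall>k. disjoint_family (\<lambda>j. R j k) \<and> Coprod Q k = (\<Union>j. R j k)"
    unfolding coprod_eq_def by (elim exE conjE)
  define e where "e = (\<lambda>i k. prod_encode (i, k))"
  have PQ: "P i k = Coprod P (e i k)" "Q i k = Coprod Q (e i k)" for i k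
    by (simp_all add: Coprod_def e_def)
  \<comment> \<open>The \<open>k\<close>-th member of \<open>P i\<close> has index \<open>e i k\<close> in the coproduct, so \<open>h i j\<close> collects all that \<open>R\<close> matches
    between members of \<open>P i\<close> and members of \<open>Q j\<close>.\<close>
  define h where "h i j x = (\<Sum>k. \<Sum>l. indicator (R (e i k) (e j l)) x :: ennreal)" for i j x
  have reindex: "(\<Sum>n. u n) = (\<Sum>j. \<Sum>l. u (e j l))" for u :: "nat \<Rightarrow> ennreal"
    using suminf_ennreal_2dimen[of "\<lambda>j. \<Sum>l. u (e j l)" "\<lambda>p. u (prod_encode p)"]
    by (simp add: e_def)
  have "h i j \<in> counting M" for i j
    using R(1) unfolding h_def[abs_def] by (intro counting_suminf counting_indicator) simp
  moreover have "f i x = (\<Sum>j. h i j x)" for i x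
  proof -
    have "f i x = (\<Sum>k. indicator (Coprod P (e i k)) x)"
      by (simp add: PQ tally_def flip: P(2))
    also have "\<dots> = (\<Sum>k. \<Sum>n. indicator (R (e i k) n) x)"
      using R(2) by (intro suminf_cong) (metis suminf_indicator)
    also have "\<dots> = (\<Sum>k. \<Sum>j. \<Sum>l. indicator (R (e i k) (e j l)) x)"
      by (subst reindex) (rule refl)
    also have "\<dots> = (\<Sum>j. h i j x)"
      unfolding h_def by (rule suminf_ennreal_swap)
    finally show ?thesis .
  qed
  moreover have "g j x = (\<Sum>i. h i j x)" for j x
  proof -
    have "g j x = (\<Sum>l. indicator (Coprod Q (e j l)) x)"
      by (simp add: PQ tally_def flip: Q(2))
    also have "\<dots> = (\<Sum>l. \<Sum>n. indicator (R n (e j l)) x)"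
      using R(3) by (intro suminf_cong) (metis suminf_indicator)
    also have "\<dots> = (\<Sum>l. \<Sum>i. \<Sum>k. indicator (R (e i k) (e j l)) x)"
      by (subst reindex) (rule refl)
    also have "\<dots> = (\<Sum>i. \<Sum>l. \<Sum>k. indicator (R (e i k) (e j l)) x)"
      by (rule suminf_ennreal_swap)
    also have "\<dots> = (\<Sum>i. h i j x)"
      unfolding h_def by (intro suminf_cong suminf_ennreal_swap)
    finally show ?thesis .
  qed
  ultimately show thesis
    by (rule that)
qed

lemma suminf_Suc_ennreal: "(\<Sum>i. f i) = f 0 + (\<Sum>i. f (Suc i))" for f :: "nat \<Rightarrow> ennreal"
  using suminf_offset[of f 1] by (simp add: add.commute)

lemma suminf_const_idem: "(\<Sum>n::nat. c) + (\<Sum>n::nat. c) = (\<Sum>n::nat. c)" for c :: ennreal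
proof -
  have "(\<Sum>n::nat. 1 :: ennreal) = \<infinity>"
    by (simp add: suminf_eq_SUP ennreal_SUP_of_nat_eq_top)
  then have "(\<Sum>n::nat. c) = c * \<infinity>"
    using ennreal_suminf_cmult[of c "\<lambda>_. 1"] by simp
  moreover have "c * \<infinity> + c * \<infinity> = c * (\<infinity> + \<infinity>)"
    by (rule distrib_left[symmetric])
  ultimately show ?thesis
    by simp
qed

text \<open>Binary sums are series padded with zeros, so statements about series specialise to them. The
  conditional selects the function and not its value, as these series arise from sequences of
  functions.\<close>

lemma suminf_two:
  fixes f g :: "'b \<Rightarrow> ennreal"
  shows "(\<Sum>i::nat. (if i = 0 then f else if i = 1 then g else (\<lambda>_. 0)) x) = f x + g x"
proof -
  have "(\<Sum>i::nat. (if i = 0 then f else if i = 1 then g else (\<lambda>_. 0)) x) =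
      (\<Sum>i\<in>{0, 1::nat}. (if i = 0 then f else if i = 1 then g else (\<lambda>_. 0)) x)"
    by (rule suminf_finite) auto
  then show ?thesis by simp
qed

text \<open>Passing to the limit in the finite form of the recursion is possible for all extended values,
  since addition is continuous on \<^typ>\<open>ennreal\<close>.\<close>

lemma decreasing_remainder:
  fixes F G :: "nat \<Rightarrow> ennreal"
  assumes "\<And>n. F n = G n + F (Suc n)"
  shows "F n = (INF k. F k) + (\<Sum>i. G (n + i))"
proof -
  have partial: "F n = (\<Sum>i<k. G (n + i)) + F (n + k)" for k
  proof (induction k)
    case (Suc k)
    then show ?case
      using assms[of "n + k"] by (simp add: add.assoc)
  qed simp
  have "decseq F"
  proof (rule decseq_SucI)
    show "F (Suc n) \<le> F n" for n
      by (subst (2) assms) simp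
  qed
  then have "(\<lambda>k. F (n + k)) \<longlonglongrightarrow> (INF k. F k)"
    using LIMSEQ_ignore_initial_segment[OF LIMSEQ_INF, of F n] by (simp add: add.commute)
  moreover have "(\<lambda>k. \<Sum>i<k. G (n + i)) \<longlonglongrightarrow> (\<Sum>i. G (n + i))"
    by (intro summable_LIMSEQ summableI)
  ultimately have "(\<lambda>k. (\<Sum>i<k. G (n + i)) + F (n + k)) \<longlonglongrightarrow> (\<Sum>i. G (n + i)) + (INF k. F k)"
    by (intro tendsto_add)
  then have "(\<lambda>k. F n) \<longlonglongrightarrow> (\<Sum>i. G (n + i)) + (INF k. F k)"
    by (simp flip: partial)
  then show ?thesis
    by (simp add: LIMSEQ_const_iff add.commute)
qed

section \<open>Inverse monoids\<close>

context inverse_monoid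
begin

definition star :: "'a \<Rightarrow> 'a" where
  "star s = (THE t. t \<in> carrier S \<and> s \<otimes> t \<otimes> s = s \<and> t \<otimes> s \<otimes> t = t)"

lemma star:
  assumes "s \<in> carrier S"
  shows star_closed [simp]: "star s \<in> carrier S"
    and star_left: "s \<otimes> star s \<otimes> s = s"
    and star_right: "star s \<otimes> s \<otimes> star s = star s"
  using theI'[OF ex1_weak_inverse[OF assms]] by (simp_all add: star_def)

lemma star_unique:
  "s \<in> carrier S \<Longrightarrow> t \<in> carrier S \<Longrightarrow> s \<otimes> t \<otimes> s = s \<Longrightarrow> t \<otimes> s \<otimes> t = t \<Longrightarrow> t = star s"
  using ex1_weak_inverse[of s] star[of s] by blast

lemma star_idempotent: "e \<in> carrier S \<Longrightarrow> e \<otimes> e = e \<Longrightarrow> star e = e"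
  by (rule star_unique[symmetric]) simp_all

text \<open>With \<open>x\<close> the weak inverse of \<open>e \<otimes> f\<close>, the element \<open>f \<otimes> x \<otimes> e\<close> is an idempotent having \<open>e \<otimes> f\<close> as
  its weak inverse. Idempotents are their own weak inverses, so the two coincide.\<close>

lemma idempotent_product:
  assumes e: "e \<in> carrier S" "e \<otimes> e = e" and f: "f \<in> carrier S" "f \<otimes> f = f"
  shows "(e \<otimes> f) \<otimes> (e \<otimes> f) = e \<otimes> f"
proof -
  define x where "x = star (e \<otimes> f)"
  have x: "x \<in> carrier S" "e \<otimes> (f \<otimes> (x \<otimes> (e \<otimes> f))) = e \<otimes> f" "x \<otimes> (e \<otimes> (f \<otimes> x)) = x"
    using star[of "e \<otimes> f"] e(1) f(1) by (simp_all add: x_def m_assoc)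
  have ee: "e \<otimes> (e \<otimes> y) = e \<otimes> y" and ff: "f \<otimes> (f \<otimes> y) = f \<otimes> y" if "y \<in> carrier S" for y
    using that e f by (simp_all flip: m_assoc)
  define y where "y = f \<otimes> x \<otimes> e"
  have yc: "y \<in> carrier S"
    using e f x by (simp add: y_def)
  have "y \<otimes> y = f \<otimes> (x \<otimes> (e \<otimes> (f \<otimes> x))) \<otimes> e"
    using e(1) f(1) x(1) by (simp add: y_def m_assoc)
  then have yy: "y \<otimes> y = y"
    by (simp add: x(3) y_def)
  have "(e \<otimes> f) \<otimes> y \<otimes> (e \<otimes> f) = e \<otimes> f"
    using e(1) f(1) x(1,2) by (simp add: y_def m_assoc ee ff)
  moreover have "y \<otimes> (e \<otimes> f) \<otimes> y = y"
  proof -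
    have "y \<otimes> (e \<otimes> f) \<otimes> y = f \<otimes> (x \<otimes> (e \<otimes> (f \<otimes> x))) \<otimes> e"
      using e(1) f(1) x(1) by (simp add: y_def m_assoc ee ff)
    then show ?thesis
      by (simp add: x(3) y_def)
  qed
  ultimately have "e \<otimes> f = star y"
    using e f yc by (intro star_unique) simp_all
  also have "\<dots> = y"
    using yc yy by (rule star_idempotent)
  finally show ?thesis
    using yy by simp
qed

text \<open>Both \<open>f \<otimes> e\<close> and \<open>e \<otimes> f\<close> are weak inverses of \<open>e \<otimes> f\<close>.\<close>

lemma idempotents_commute:
  assumes e: "e \<in> carrier S" "e \<otimes> e = e" and f: "f \<in> carrier S" "f \<otimes> f = f"
  shows "e \<otimes> f = f \<otimes> e"
proof -
  have ee: "e \<otimes> (e \<otimes> y) = e \<otimes> y" and ff: "f \<otimes> (f \<otimes> y) = f \<otimes> y" if "y \<in> carrier S" for y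
    using that e f by (simp_all flip: m_assoc)
  have p: "e \<otimes> (f \<otimes> (e \<otimes> f)) = e \<otimes> f" "f \<otimes> (e \<otimes> (f \<otimes> e)) = f \<otimes> e"
    using idempotent_product[OF e f] idempotent_product[OF f e] e(1) f(1) by (simp_all add: m_assoc)
  have "f \<otimes> e = star (e \<otimes> f)"
    using e(1) f(1) p by (intro star_unique) (simp_all add: m_assoc ee ff)
  also have "\<dots> = e \<otimes> f"
    using e(1) f(1) idempotent_product[OF e f] by (intro star_idempotent) simp_all
  finally show ?thesis by simp
qed

text \<open>Both \<open>s\<close> and \<open>t\<close> can be continued to the product of the idempotents \<open>s \<otimes> star s\<close> and \<open>t \<otimes> star t\<close>.\<close>

lemma common_right_multiple:
  assumes s: "s \<in> carrier S" and t: "t \<in> carrier S"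
  obtains u v where "u \<in> carrier S" "v \<in> carrier S" "s \<otimes> u = t \<otimes> v"
proof -
  define e f where "e = s \<otimes> star s" and "f = t \<otimes> star t"
  have e: "e \<in> carrier S" "e \<otimes> e = e" and f: "f \<in> carrier S" "f \<otimes> f = f"
    using s t star[of s] star[of t] by (simp_all add: e_def f_def flip: m_assoc)
  have "s \<otimes> (star s \<otimes> f) = e \<otimes> f" "t \<otimes> (star t \<otimes> e) = f \<otimes> e"
    using s t e f by (simp_all add: e_def f_def m_assoc)
  then show thesis
    using idempotents_commute[OF e f] s t e f by (intro that[of "star s \<otimes> f" "star t \<otimes> e"]) simp_all
qed

end

section \<open>Equidecomposability of counting functions\<close>

context stationarily_measurable_space
begin

text \<open>Counting functions vanish outside the space, hence the default value.\<close>

definition pullback :: "'s \<Rightarrow> ('x \<Rightarrow> ennreal) \<Rightarrow> 'x \<Rightarrow> ennreal" where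
  "pullback s f x = (if x \<in> space M then f (act s x) else 0)"

definition single_move :: "('x \<Rightarrow> ennreal) \<Rightarrow> ('x \<Rightarrow> ennreal) \<Rightarrow> bool" where
  "single_move f g \<longleftrightarrow> f \<in> counting M \<and> g \<in> counting M \<and>
     (\<exists>s \<in> carrier S. \<exists>t \<in> carrier S. pullback s f = pullback t g)"

text \<open>The counterpart of \<open>type_rel\<close> for multiplicity functions (\<open>type_rel_iff\<close>).\<close>

definition equidec :: "('x \<Rightarrow> ennreal) \<Rightarrow> ('x \<Rightarrow> ennreal) \<Rightarrow> bool" where
  "equidec f g \<longleftrightarrow> (\<exists>f' g'. (\<forall>j. single_move (f' j) (g' j)) \<and>
     f = (\<lambda>x. \<Sum>j. f' j x) \<and> g = (\<lambda>x. \<Sum>j. g' j x))"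

lemma act_closed: "s \<in> carrier S \<Longrightarrow> x \<in> space M \<Longrightarrow> act s x \<in> space M"
  by (rule measurable_space[OF act_measurable])

lemma pullback_counting:
  assumes s: "s \<in> carrier S" and f: "f \<in> counting M"
  shows "pullback s f \<in> counting M"
proof -
  have [measurable]: "act s \<in> measurable M M"
    using s by (rule act_measurable)
  have [measurable]: "f \<in> borel_measurable M"
    using f by (rule counting_measurable)
  have "pullback s f \<in> borel_measurable M"
    unfolding pullback_def[abs_def] by (subst measurable_cong[where g = "\<lambda>x. f (act s x)"]) simp_all
  moreover have "0 \<in> range ennreal_of_enat"
    by (rule range_eqI[of _ _ 0]) simp
  moreover have "f (act s x) \<in> range ennreal_of_enat" for x
    using f by (simp add: counting_def)
  ultimately show ?thesis
    by (intro countingI) (simp_all add: pullback_def)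
qed

lemma pullback_mult:
  "s \<in> carrier S \<Longrightarrow> t \<in> carrier S \<Longrightarrow> pullback (s \<otimes> t) f = pullback t (pullback s f)"
  by (auto simp: pullback_def act_closed act_mult)

lemma tally_family_vimage: "tally (family_vimage M (act s) P) = pullback s (tally P)"
  by (auto simp: tally_def family_vimage_def pullback_def indicator_def)

lemma single_move_refl: "f \<in> counting M \<Longrightarrow> single_move f f"
  unfolding single_move_def by blast

lemma single_move_sym: "single_move f g \<Longrightarrow> single_move g f"
  unfolding single_move_def by (auto dest: sym)

text \<open>The two moves meet in the middle function, which is pulled back along \<open>t\<close> by the first and along \<open>u\<close>
  by the second; a common right multiple of \<open>t\<close> and \<open>u\<close> makes these pullbacks comparable.\<close>

lemma single_move_trans:
  assumes "single_move f g" "single_move g h"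
  shows "single_move f h"
proof -
  obtain s t where st: "s \<in> carrier S" "t \<in> carrier S" "pullback s f = pullback t g"
    using assms(1) by (auto simp: single_move_def)
  obtain u v where uv: "u \<in> carrier S" "v \<in> carrier S" "pullback u g = pullback v h"
    using assms(2) by (auto simp: single_move_def)
  obtain a b where ab: "a \<in> carrier S" "b \<in> carrier S" "t \<otimes> a = u \<otimes> b"
    using common_right_multiple[OF st(2) uv(1)] by blast
  have "pullback (s \<otimes> a) f = pullback (t \<otimes> a) g"
    using st ab(1) by (simp add: pullback_mult)
  also have "\<dots> = pullback (v \<otimes> b) h"
    unfolding ab(3) using uv ab(2) by (simp add: pullback_mult)
  finally show ?thesis
    using assms st uv ab unfolding single_move_def
    by (intro conjI bexI[of _ "s \<otimes> a"] bexI[of _ "v \<otimes> b"]) simp_all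
qed

text \<open>Let \<open>pullback s f = pullback t g\<close>. Pulling the summands of \<open>g\<close> back along \<open>t \<otimes> star s\<close> splits \<open>pullback e f\<close>
  with \<open>e = s \<otimes> star s\<close>, which agrees with \<open>f\<close> where \<open>Q\<close> holds. Elsewhere \<open>f\<close> is put entirely into the
  summand with index zero. This does no harm, because \<open>e \<otimes> s = s\<close> shows that \<open>act s\<close> maps into the
  region where \<open>Q\<close> holds.\<close>

lemma single_move_lift:
  assumes fg: "single_move f g" and g: "\<And>k. g' k \<in> counting M" "g = (\<lambda>x. \<Sum>k. g' k x)"
  obtains f' where "\<And>k. single_move (f' k) (g' k)" "f = (\<lambda>x. \<Sum>k. f' k x)"
proof -
  obtain s t where s: "s \<in> carrier S" and t: "t \<in> carrier S" and eq: "pullback s f = pullback t g"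
    and f: "f \<in> counting M"
    using fg by (auto simp: single_move_def)
  define e where "e = s \<otimes> star s"
  define Q where "Q x \<longleftrightarrow> f x = pullback e f x" for x
  have e: "e \<in> carrier S" and es: "e \<otimes> s = s"
    using s star[OF s] by (simp_all add: e_def)
  have Q: "Measurable.pred M Q"
    using f pullback_counting[OF e f] unfolding Q_def[abs_def] by measurable
  have Qs: "Q (act s x)" if "x \<in> space M" for x
    using that s e act_mult[OF e s that] by (simp add: Q_def pullback_def act_closed es)
  define f' where "f' k x = (if Q x then pullback (t \<otimes> star s) (g' k) x else if k = 0 then f x else 0)"
    for k x
  have f'c: "f' k \<in> counting M" for k
    using s t g f Q counting_zero[of M] unfolding f'_def[abs_def]
    by (intro counting_if) (auto intro: pullback_counting)
  have "single_move (f' k) (g' k)" for k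
  proof -
    have "pullback s (f' k) = pullback s (pullback (t \<otimes> star s) (g' k))"
      using Qs by (auto simp: pullback_def f'_def)
    also have "\<dots> = pullback (t \<otimes> star s \<otimes> s) (g' k)"
      using s t by (simp add: pullback_mult)
    finally show ?thesis
      unfolding single_move_def using s t f'c g(1)
      by (intro conjI bexI[of _ s] bexI[of _ "t \<otimes> star s \<otimes> s"]) simp_all
  qed
  moreover have "f x = (\<Sum>k. f' k x)" for x
  proof (cases "Q x")
    case True
    have "(\<Sum>k. f' k x) = pullback (t \<otimes> star s) g x"
      using True by (auto simp: f'_def pullback_def g(2))
    also have "\<dots> = pullback (star s) (pullback s f) x"
      using s t by (simp add: pullback_mult eq)
    also have "\<dots> = f x"
      using True s by (simp add: pullback_mult Q_def e_def)
    finally show ?thesis by simp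
  next
    case False
    then have "(\<Sum>k. f' k x) = (\<Sum>k\<in>{0}. f' k x)"
      by (intro suminf_finite) (simp_all add: f'_def)
    then show ?thesis
      using False by (simp add: f'_def)
  qed
  ultimately show thesis
    by (intro that) auto
qed

lemma equidec_counting:
  assumes "equidec f g"
  shows "f \<in> counting M" "g \<in> counting M"
  using assms unfolding equidec_def single_move_def by (auto intro: counting_suminf)

lemma equidecI:
  "(\<And>j. single_move (f' j) (g' j)) \<Longrightarrow> f = (\<lambda>x. \<Sum>j. f' j x) \<Longrightarrow> g = (\<lambda>x. \<Sum>j. g' j x) \<Longrightarrow>
    equidec f g"
  unfolding equidec_def by (intro exI[of _ f'] exI[of _ g']) simp

lemma equidecE:
  assumes "equidec f g"
  obtains f' g' where "\<forall>j. single_move (f' j) (g' j)"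
    "f = (\<lambda>x. \<Sum>j. f' j x)" "g = (\<lambda>x. \<Sum>j. g' j x)"
  using assms unfolding equidec_def by (elim exE conjE) (rule that)

lemma equidec_sym: "equidec f g \<Longrightarrow> equidec g f"
  by (erule equidecE, rule equidecI, rule single_move_sym, erule spec)

lemma equidec_suminf:
  assumes "\<And>i. equidec (f i) (g i)"
  shows "equidec (\<lambda>x. \<Sum>i. f i x) (\<lambda>x. \<Sum>i. g i x)"
proof -
  have "\<forall>i. \<exists>p. (\<forall>j. single_move (fst p j) (snd p j)) \<and>
      f i = (\<lambda>x. \<Sum>j. fst p j x) \<and> g i = (\<lambda>x. \<Sum>j. snd p j x)"
    using assms unfolding equidec_def by simp
  from choice[OF this] obtain p where p: "\<And>i j. single_move (fst (p i) j) (snd (p i) j)"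
    "\<And>i. f i = (\<lambda>x. \<Sum>j. fst (p i) j x)" "\<And>i. g i = (\<lambda>x. \<Sum>j. snd (p i) j x)"
    by blast
  define F where "F = (\<lambda>(i, j). fst (p i) j)"
  define G where "G = (\<lambda>(i, j). snd (p i) j)"
  have "single_move (F (prod_decode n)) (G (prod_decode n))" for n
    using p(1) by (simp add: F_def G_def split: prod.split)
  moreover have "(\<Sum>i. f i x) = (\<Sum>n. F (prod_decode n) x)" for x
    by (rule suminf_ennreal_2dimen[symmetric]) (simp add: p(2) F_def)
  moreover have "(\<Sum>i. g i x) = (\<Sum>n. G (prod_decode n) x)" for x
    by (rule suminf_ennreal_2dimen[symmetric]) (simp add: p(3) G_def)
  ultimately show ?thesis
    by (intro equidecI[of "\<lambda>n. F (prod_decode n)" "\<lambda>n. G (prod_decode n)"]) auto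
qed

lemma single_move_equidec:
  assumes "single_move f g"
  shows "equidec f g"
proof -
  have z: "single_move (\<lambda>_. 0) (\<lambda>_. 0)"
    using counting_zero by (rule single_move_refl)
  show ?thesis
    by (rule equidecI[of "\<lambda>i. if i = 0 then f else if i = 1 then (\<lambda>_. 0) else (\<lambda>_. 0)"
        "\<lambda>i. if i = 0 then g else if i = 1 then (\<lambda>_. 0) else (\<lambda>_. 0)"])
      (simp add: assms z, simp_all only: suminf_two add_0_right)
qed

lemma equidec_refl: "f \<in> counting M \<Longrightarrow> equidec f f"
  by (intro single_move_equidec single_move_refl)

lemma equidec_add:
  assumes "equidec f g" "equidec f' g'"
  shows "equidec (\<lambda>x. f x + f' x) (\<lambda>x. g x + g' x)"
proof -
  have "equidec (\<lambda>x. \<Sum>i. (if i = 0 then f else if i = 1 then f' else (\<lambda>_. 0)) x)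
      (\<lambda>x. \<Sum>i. (if i = 0 then g else if i = 1 then g' else (\<lambda>_. 0)) x)"
    using assms equidec_refl[OF counting_zero] by (intro equidec_suminf) simp
  then show ?thesis
    by (simp only: suminf_two)
qed

text \<open>The given splitting of \<open>g\<close> and the one that witnesses \<open>equidec f g\<close> have a common refinement, whose
  pieces are copied to \<open>f\<close> along the single moves.\<close>

lemma equidec_lift:
  assumes fg: "equidec f g" and g: "\<And>i. g' i \<in> counting M" "g = (\<lambda>x. \<Sum>i. g' i x)"
  obtains f' where "\<And>i. equidec (f' i) (g' i)" "f = (\<lambda>x. \<Sum>i. f' i x)"
proof -
  obtain p q where pq: "\<forall>j. single_move (p j) (q j)" "f = (\<lambda>x. \<Sum>j. p j x)" "g = (\<lambda>x. \<Sum>j. q j x)"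
    using fg by (rule equidecE)
  have q: "q j \<in> counting M" for j
    using pq(1) by (simp add: single_move_def)
  have eq: "(\<Sum>i. g' i x) = (\<Sum>j. q j x)" for x
    using fun_cong[OF trans[OF g(2)[symmetric] pq(3)], of x] by simp
  obtain h where h: "\<And>i j. h i j \<in> counting M" "\<And>i x. g' i x = (\<Sum>j. h i j x)"
    "\<And>j x. q j x = (\<Sum>i. h i j x)"
    by (fact counting_refinement[OF g(1) q eq])
  have "\<forall>j. \<exists>r. (\<forall>i. single_move (r i) (h i j)) \<and> p j = (\<lambda>x. \<Sum>i. r i x)"
  proof
    fix j
    have q_eq: "q j = (\<lambda>x. \<Sum>i. h i j x)"
      using h(3) by (rule ext)
    obtain r where "\<And>i. single_move (r i) (h i j)" "p j = (\<lambda>x. \<Sum>i. r i x)"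
      by (fact single_move_lift[OF pq(1)[rule_format] h(1) q_eq])
    then show "\<exists>r. (\<forall>i. single_move (r i) (h i j)) \<and> p j = (\<lambda>x. \<Sum>i. r i x)"
      by (intro exI[of _ r]) simp
  qed
  from choice[OF this] obtain r where r: "\<And>i j. single_move (r j i) (h i j)"
    "\<And>j. p j = (\<lambda>x. \<Sum>i. r j i x)"
    by blast
  have "equidec (\<lambda>x. \<Sum>j. r j i x) (g' i)" for i
  proof -
    have "g' i = (\<lambda>x. \<Sum>j. h i j x)"
      using h(2) by (rule ext)
    then show ?thesis
      using r(1) by (intro equidecI[of "\<lambda>j. r j i" "h i"]) auto
  qed
  moreover have "f = (\<lambda>x. \<Sum>i. \<Sum>j. r j i x)"
    unfolding pq(2) r(2) by (rule ext) (rule suminf_ennreal_swap)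
  ultimately show thesis
    by (rule that)
qed

text \<open>The splitting of \<open>g\<close> that matches it with \<open>h\<close> is lifted to \<open>f\<close>, and the splitting of each piece obtained
  in this way is lifted along a single move to the corresponding piece of \<open>h\<close>. The two equivalences
  then pass through the same pieces of \<open>g\<close>, where single moves can be composed.\<close>

lemma equidec_trans:
  assumes fg: "equidec f g" and gh: "equidec g h"
  shows "equidec f h"
proof -
  obtain q r where qr: "\<forall>j. single_move (q j) (r j)" "g = (\<lambda>x. \<Sum>j. q j x)" "h = (\<lambda>x. \<Sum>j. r j x)"
    using gh by (rule equidecE)
  have q: "q j \<in> counting M" for j
    using qr(1) by (simp add: single_move_def)
  obtain p where p: "\<And>j. equidec (p j) (q j)" "f = (\<lambda>x. \<Sum>j. p j x)"
    by (fact equidec_lift[OF fg q qr(2)])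
  have "equidec (p j) (r j)" for j
  proof -
    obtain a b where ab: "\<forall>i. single_move (a i) (b i)" "p j = (\<lambda>x. \<Sum>i. a i x)" "q j = (\<lambda>x. \<Sum>i. b i x)"
      using p(1) by (rule equidecE)
    have b: "b i \<in> counting M" for i
      using ab(1) by (simp add: single_move_def)
    obtain c where c: "\<And>i. single_move (c i) (b i)" "r j = (\<lambda>x. \<Sum>i. c i x)"
      by (fact single_move_lift[OF single_move_sym[OF qr(1)[rule_format]] b ab(3)])
    have "single_move (a i) (c i)" for i
      using single_move_trans[OF ab(1)[rule_format] single_move_sym[OF c(1)]] .
    then show ?thesis
      by (rule equidecI[OF _ ab(2) c(2)])
  qed
  then show ?thesis
    unfolding p(2) qr(3) by (rule equidec_suminf)
qed

lemma equidec_lift_add: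
  assumes fg: "equidec f (\<lambda>x. g x + h x)" and g: "g \<in> counting M" and h: "h \<in> counting M"
  obtains g' h' where "equidec g' g" "equidec h' h" "f = (\<lambda>x. g' x + h' x)"
proof -
  define p where "p = (\<lambda>i::nat. if i = 0 then g else if i = 1 then h else (\<lambda>_. 0))"
  have p: "p i \<in> counting M" for i
    using g h counting_zero[of M] by (simp add: p_def)
  have sum_p: "(\<lambda>x. g x + h x) = (\<lambda>x. \<Sum>i. p i x)"
    unfolding p_def suminf_two ..
  obtain f' where f': "\<And>i. equidec (f' i) (p i)" "f = (\<lambda>x. \<Sum>i. f' i x)"
    by (fact equidec_lift[OF fg p sum_p])
  have "p (Suc i) = (if i = 0 then h else if i = 1 then (\<lambda>_. 0) else (\<lambda>_. 0))" for i
    by (simp add: p_def)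
  then have "(\<lambda>x. \<Sum>i. p (Suc i) x) = h"
    by (simp only: suminf_two add_0_right)
  moreover have "equidec (\<lambda>x. \<Sum>i. f' (Suc i) x) (\<lambda>x. \<Sum>i. p (Suc i) x)"
    by (intro equidec_suminf f'(1))
  ultimately have "equidec (\<lambda>x. \<Sum>i. f' (Suc i) x) h"
    by simp
  moreover have "equidec (f' 0) g"
    using f'(1)[of 0] by (simp add: p_def)
  moreover have "f = (\<lambda>x. f' 0 x + (\<Sum>i. f' (Suc i) x))"
  proof
    fix x
    show "f x = f' 0 x + (\<Sum>i. f' (Suc i) x)"
      unfolding f'(2) by (rule suminf_Suc_ennreal)
  qed
  ultimately show thesis
    by (intro that)
qed

text \<open>By repeated lifting the equivalences become pointwise equations \<open>F n = G n + F (n + 1)\<close> starting from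
  \<open>F 0 = f 0\<close>. The remainder is the infimum of the decreasing sequence \<open>F\<close>.\<close>

lemma equidec_remainder:
  assumes f: "\<And>n. f n \<in> counting M" and g: "\<And>n. g n \<in> counting M"
    and fg: "\<And>n. equidec (f n) (\<lambda>x. g n x + f (Suc n) x)"
  obtains c where "c \<in> counting M" "\<And>n. equidec (f n) (\<lambda>x. c x + (\<Sum>i. g (n + i) x))"
proof -
  have "\<exists>F. \<forall>n. equidec (F n) (f n) \<and> (\<exists>G. equidec G (g n) \<and> F n = (\<lambda>x. G x + F (Suc n) x))"
  proof (rule dependent_nat_choice)
    show "\<exists>F. equidec F (f 0)"
      using equidec_refl[OF f] by blast
    fix F n assume "equidec F (f n)"
    then have "equidec F (\<lambda>x. g n x + f (Suc n) x)"
      using fg by (rule equidec_trans)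
    then obtain G F' where "equidec G (g n)" "equidec F' (f (Suc n))" "F = (\<lambda>x. G x + F' x)"
      using g f by (rule equidec_lift_add)
    then show "\<exists>F'. equidec F' (f (Suc n)) \<and> (\<exists>G. equidec G (g n) \<and> F = (\<lambda>x. G x + F' x))"
      by blast
  qed
  then obtain F where F: "\<forall>n. equidec (F n) (f n) \<and>
    (\<exists>G. equidec G (g n) \<and> F n = (\<lambda>x. G x + F (Suc n) x))" ..
  then have "\<forall>n. \<exists>G. equidec G (g n) \<and> F n = (\<lambda>x. G x + F (Suc n) x)"
    by blast
  from choice[OF this] obtain G
    where G: "\<forall>n. equidec (G n) (g n) \<and> F n = (\<lambda>x. G n x + F (Suc n) x)" ..
  define c where "c x = (INF n. F n x)" for x
  have c: "c \<in> counting M"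
    unfolding c_def[abs_def] using F equidec_counting(1) by (intro counting_INF) blast
  have rec: "F n x = G n x + F (Suc n) x" for n x
    using spec[OF G, of n, THEN conjunct2] by (rule fun_cong)
  have F_eq: "F n = (\<lambda>x. c x + (\<Sum>i. G (n + i) x))" for n
    unfolding c_def using decreasing_remainder[of "\<lambda>n. F n _" "\<lambda>n. G n _"] rec by blast
  have "equidec (f n) (\<lambda>x. c x + (\<Sum>i. g (n + i) x))" for n
  proof (rule equidec_trans)
    show "equidec (f n) (F n)"
      using F equidec_sym by blast
    show "equidec (F n) (\<lambda>x. c x + (\<Sum>i. g (n + i) x))"
      unfolding F_eq[of n] using G c by (intro equidec_add equidec_suminf equidec_refl) auto
  qed
  then show thesis
    using c by (intro that)
qed

end

section \<open>The type monoid as a cardinal algebra\<close>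

lemma empty_family_in_families: "empty_family \<in> families M"
  by (simp add: empty_family_def families_def)

lemma single_family_in_families: "A \<in> sets M \<Longrightarrow> single_family A \<in> families M"
  by (simp add: single_family_def families_def)

lemma tally_empty_family: "tally empty_family = (\<lambda>_. 0)"
  by (simp add: tally_def empty_family_def fun_eq_iff)

lemma tally_single_family: "tally (single_family A) = indicator A"
proof
  fix x
  have "tally (single_family A) x = (\<Sum>j\<in>{0}. indicator (single_family A j) x)"
    unfolding tally_def by (rule suminf_finite) (simp_all add: single_family_def)
  then show "tally (single_family A) x = indicator A x"
    by (simp add: single_family_def)
qed

lemma coprod_in_families: "P \<in> families M \<Longrightarrow> Q \<in> families M \<Longrightarrow> coprod P Q \<in> families M"
  unfolding coprod_def by (intro Coprod_in_families) (simp add: empty_family_in_families)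

lemma tally_coprod: "tally (coprod P Q) = (\<lambda>x. tally P x + tally Q x)"
proof
  fix x
  have "tally (coprod P Q) x =
      (\<Sum>i. (if i = 0 then tally P else if i = 1 then tally Q else (\<lambda>_. 0)) x)"
    unfolding coprod_def tally_Coprod by (intro suminf_cong) (simp add: tally_empty_family)
  then show "tally (coprod P Q) x = tally P x + tally Q x"
    by (simp only: suminf_two)
qed

context stationarily_measurable_space
begin

abbreviation "\<T> \<equiv> type_monoid M S act"
abbreviation "\<Sigma>\<T> \<equiv> type_sum M S act"

lemma type_rel_iff:
  "(P, Q) \<in> type_rel M S act \<longleftrightarrow>
    P \<in> families M \<and> Q \<in> families M \<and> equidec (tally P) (tally Q)"
proof (intro iffI conjI; (elim conjE)?)
  assume "(P, Q) \<in> type_rel M S act"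
  then obtain P' Q' s t where P: "P \<in> families M" and Q: "Q \<in> families M" and
    *: "\<forall>j. P' j \<in> families M \<and> Q' j \<in> families M \<and> s j \<in> carrier S \<and> t j \<in> carrier S"
    "coprod_eq M P (Coprod P')" "coprod_eq M Q (Coprod Q')"
    "\<forall>j. coprod_eq M (family_vimage M (act (s j)) (P' j)) (family_vimage M (act (t j)) (Q' j))"
    unfolding type_rel_def by auto
  show "P \<in> families M" "Q \<in> families M"
    by (fact P Q)+
  have "tally P = tally (Coprod P')" "tally Q = tally (Coprod Q')"
    using * P Q coprod_eq_iff_tally[of P M "Coprod P'"] coprod_eq_iff_tally[of Q M "Coprod Q'"]
    by (simp_all add: Coprod_in_families)
  then have "tally P = (\<lambda>x. \<Sum>j. tally (P' j) x)" "tally Q = (\<lambda>x. \<Sum>j. tally (Q' j) x)"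
    by (simp_all add: tally_Coprod fun_eq_iff)
  moreover have "single_move (tally (P' j)) (tally (Q' j))" for j
  proof -
    have vimage: "family_vimage M (act r) R \<in> families M" if "r \<in> carrier S" "R \<in> families M" for r R
      using that act_measurable[of r] by (simp add: family_vimage_def families_def measurable_sets)
    have "tally (family_vimage M (act (s j)) (P' j)) = tally (family_vimage M (act (t j)) (Q' j))"
      using *(1,4) coprod_eq_iff_tally[OF vimage vimage, of "s j" "P' j" "t j" "Q' j"] by simp
    then show ?thesis
      using *(1) unfolding single_move_def
      by (intro conjI bexI[of _ "s j"] bexI[of _ "t j"]) (simp_all add: tally_in_counting tally_family_vimage)
  qed
  ultimately show "equidec (tally P) (tally Q)"
    by (intro equidecI[of "\<lambda>j. tally (P' j)" "\<lambda>j. tally (Q' j)"])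
next
  assume P: "P \<in> families M" and Q: "Q \<in> families M" and eq: "equidec (tally P) (tally Q)"
  obtain f g where fg: "\<forall>j. single_move (f j) (g j)"
    "tally P = (\<lambda>x. \<Sum>j. f j x)" "tally Q = (\<lambda>x. \<Sum>j. g j x)"
    using eq by (rule equidecE)
  have "\<forall>j. \<exists>P'. P' \<in> families M \<and> tally P' = f j"
    using fg(1) unfolding single_move_def by (meson counting_eq_tally)
  from choice[OF this] obtain P' where P': "\<And>j. P' j \<in> families M" "\<And>j. tally (P' j) = f j"
    by blast
  have "\<forall>j. \<exists>P'. P' \<in> families M \<and> tally P' = g j"
    using fg(1) unfolding single_move_def by (meson counting_eq_tally)
  from choice[OF this] obtain Q' where Q': "\<And>j. Q' j \<in> families M" "\<And>j. tally (Q' j) = g j"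
    by blast
  have "\<forall>j. \<exists>p. fst p \<in> carrier S \<and> snd p \<in> carrier S \<and> pullback (fst p) (f j) = pullback (snd p) (g j)"
    using fg(1) unfolding single_move_def split_paired_Ex fst_conv snd_conv by blast
  from choice[OF this] obtain p where p: "\<And>j. fst (p j) \<in> carrier S" "\<And>j. snd (p j) \<in> carrier S"
    "\<And>j. pullback (fst (p j)) (f j) = pullback (snd (p j)) (g j)"
    by blast
  have vimage: "family_vimage M (act r) R \<in> families M" if "r \<in> carrier S" "R \<in> families M" for r R
    using that act_measurable[of r] by (simp add: family_vimage_def families_def measurable_sets)
  have "coprod_eq M P (Coprod P')" "coprod_eq M Q (Coprod Q')"
    using P Q P' Q' fg(2,3) by (simp_all add: coprod_eq_iff_tally Coprod_in_families tally_Coprod fun_eq_iff)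
  moreover have "coprod_eq M (family_vimage M (act (fst (p j))) (P' j))
      (family_vimage M (act (snd (p j))) (Q' j))" for j
    using P' Q' p by (simp add: coprod_eq_iff_tally vimage tally_family_vimage)
  ultimately show "(P, Q) \<in> type_rel M S act"
    unfolding type_rel_def using P Q P'(1) Q'(1) p(1,2)
    by (intro CollectI case_prodI conjI exI[of _ P'] exI[of _ Q'] exI[of _ "\<lambda>j. fst (p j)"]
        exI[of _ "\<lambda>j. snd (p j)"]) simp_all
qed

text \<open>For counting functions \<open>f\<close> these are the elements of the type monoid (\<open>carrier_type_monoid\<close>), which
  frees its arithmetic from the choice of families.\<close>

definition type_of :: "('x \<Rightarrow> ennreal) \<Rightarrow> 'x family set" where
  "type_of f = {Q \<in> families M. equidec f (tally Q)}"

text \<open>The operations of the type monoid saturate a set of representatives. This identifies the result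
  as soon as all the representatives in that set are equivalent.\<close>

lemma type_rel_Image_eq:
  assumes f: "f \<in> counting M" and \<P>: "\<P> \<subseteq> families M"
    and ex: "\<exists>P \<in> \<P>. equidec f (tally P)" and all: "\<And>P. P \<in> \<P> \<Longrightarrow> equidec f (tally P)"
  shows "type_rel M S act `` \<P> = type_of f"
proof (intro Set.set_eqI iffI)
  fix Q assume "Q \<in> type_rel M S act `` \<P>"
  then obtain P where "P \<in> \<P>" "Q \<in> families M" "equidec (tally P) (tally Q)"
    by (auto simp: type_rel_iff)
  then show "Q \<in> type_of f"
    using equidec_trans[OF all] by (simp add: type_of_def)
next
  fix Q assume Q: "Q \<in> type_of f"
  obtain P where P: "P \<in> \<P>" "equidec f (tally P)"
    using ex by blast
  have "equidec (tally P) (tally Q)"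
    using equidec_trans[OF equidec_sym[OF P(2)]] Q by (simp add: type_of_def)
  then have "(P, Q) \<in> type_rel M S act"
    using P \<P> Q by (auto simp: type_rel_iff type_of_def)
  then show "Q \<in> type_rel M S act `` \<P>"
    using P(1) by blast
qed

lemma type_of_eq_iff:
  assumes "f \<in> counting M" "g \<in> counting M"
  shows "type_of f = type_of g \<longleftrightarrow> equidec f g"
proof
  assume eq: "type_of f = type_of g"
  obtain P where P: "P \<in> families M" "tally P = f"
    using assms(1) by (rule counting_eq_tally)
  then have "P \<in> type_of f"
    using equidec_refl[OF assms(1)] by (simp add: type_of_def)
  then have "P \<in> type_of g"
    unfolding eq .
  then show "equidec f g"
    using P by (simp add: type_of_def equidec_sym)
next
  assume fg: "equidec f g"
  show "type_of f = type_of g"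
    using equidec_trans[OF fg] equidec_trans[OF equidec_sym[OF fg]] by (auto simp: type_of_def)
qed

lemma type_rel_class: "P \<in> families M \<Longrightarrow> type_rel M S act `` {P} = type_of (tally P)"
  by (rule type_rel_Image_eq) (auto simp: tally_in_counting equidec_refl)

lemma carrier_type_monoid: "carrier \<T> = type_of ` counting M"
proof -
  have "carrier \<T> = (\<lambda>P. type_of (tally P)) ` families M"
    by (auto simp: type_monoid_def quotient_def type_rel_class)
  also have "\<dots> = type_of ` counting M"
    by (auto intro: tally_in_counting elim!: counting_eq_tally)
  finally show ?thesis .
qed

lemma type_of_in_carrier: "f \<in> counting M \<Longrightarrow> type_of f \<in> carrier \<T>"
  by (simp add: carrier_type_monoid)

lemma one_type_monoid: "\<one>\<^bsub>\<T>\<^esub> = type_of (\<lambda>_. 0)"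
  by (simp add: type_monoid_def type_rel_class empty_family_in_families tally_empty_family)

lemma mult_type_of:
  assumes f: "f \<in> counting M" and g: "g \<in> counting M"
  shows "type_of f \<otimes>\<^bsub>\<T>\<^esub> type_of g = type_of (\<lambda>x. f x + g x)"
proof -
  obtain P Q where P: "P \<in> families M" "tally P = f" and Q: "Q \<in> families M" "tally Q = g"
    using f g by (meson counting_eq_tally)
  have "type_rel M S act `` {coprod P Q | P Q. P \<in> type_of f \<and> Q \<in> type_of g} =
      type_of (\<lambda>x. f x + g x)"
  proof (rule type_rel_Image_eq)
    show "(\<lambda>x. f x + g x) \<in> counting M"
      using f g by (rule counting_add)
    show "{coprod P Q | P Q. P \<in> type_of f \<and> Q \<in> type_of g} \<subseteq> families M"
      by (auto simp: type_of_def intro: coprod_in_families)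
    show all: "equidec (\<lambda>x. f x + g x) (tally R)"
      if "R \<in> {coprod P Q | P Q. P \<in> type_of f \<and> Q \<in> type_of g}" for R
      using that by (auto simp: type_of_def tally_coprod intro: equidec_add)
    have "P \<in> type_of f" "Q \<in> type_of g"
      using P Q equidec_refl[OF f] equidec_refl[OF g] by (simp_all add: type_of_def)
    then have "coprod P Q \<in> {coprod P Q | P Q. P \<in> type_of f \<and> Q \<in> type_of g}"
      by blast
    then show "\<exists>R \<in> {coprod P Q | P Q. P \<in> type_of f \<and> Q \<in> type_of g}.
        equidec (\<lambda>x. f x + g x) (tally R)"
      using all by blast
  qed
  then show ?thesis
    by (simp add: type_monoid_def)
qed

lemma type_sum_type_of:
  assumes f: "\<And>i. f i \<in> counting M"
  shows "\<Sigma>\<T> (\<lambda>i. type_of (f i)) = type_of (\<lambda>x. \<Sum>i. f i x)"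
  unfolding type_sum_def
proof (rule type_rel_Image_eq)
  show "(\<lambda>x. \<Sum>i. f i x) \<in> counting M"
    using f by (rule counting_suminf)
  show "{Coprod P | P. \<forall>i. P i \<in> type_of (f i)} \<subseteq> families M"
    by (auto simp: type_of_def intro: Coprod_in_families)
  show all: "equidec (\<lambda>x. \<Sum>i. f i x) (tally R)"
    if R: "R \<in> {Coprod P | P. \<forall>i. P i \<in> type_of (f i)}" for R
  proof -
    obtain P where P: "R = Coprod P" "\<forall>i. P i \<in> type_of (f i)"
      using R by blast
    have "tally R = (\<lambda>x. \<Sum>i. tally (P i) x)"
      by (simp add: P(1) tally_Coprod fun_eq_iff)
    moreover have "equidec (f i) (tally (P i))" for i
      using P(2) by (simp add: type_of_def)
    ultimately show ?thesis
      using equidec_suminf[of f "\<lambda>i. tally (P i)"] by simp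
  qed
  have "\<forall>i. \<exists>P. P \<in> families M \<and> tally P = f i"
    using f by (meson counting_eq_tally)
  from choice[OF this] obtain P where "\<forall>i. P i \<in> families M \<and> tally (P i) = f i" ..
  then have "\<forall>i. P i \<in> type_of (f i)"
    using f by (auto simp: type_of_def equidec_refl)
  then have "Coprod P \<in> {Coprod P | P. \<forall>i. P i \<in> type_of (f i)}"
    by blast
  then show "\<exists>R \<in> {Coprod P | P. \<forall>i. P i \<in> type_of (f i)}. equidec (\<lambda>x. \<Sum>i. f i x) (tally R)"
    using all by blast
qed

lemma carrier_type_monoidE:
  assumes "a \<in> carrier \<T>"
  obtains f where "f \<in> counting M" "a = type_of f"
  using assms by (auto simp: carrier_type_monoid)

lemma carrier_type_monoid_seqE:
  assumes "\<And>n. a n \<in> carrier \<T>"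
  obtains f where "\<And>n. f n \<in> counting M" "a = (\<lambda>n. type_of (f n))"
proof -
  have "\<forall>n. \<exists>f. f \<in> counting M \<and> a n = type_of f"
    using assms by (auto simp: carrier_type_monoid)
  from choice[OF this] obtain f where "\<forall>n. f n \<in> counting M \<and> a n = type_of (f n)" ..
  then show thesis
    by (intro that[of f]) auto
qed

lemma comm_monoid_type_monoid: "comm_monoid \<T>"
proof (rule comm_monoidI)
  show "\<one>\<^bsub>\<T>\<^esub> \<in> carrier \<T>"
    by (simp add: one_type_monoid type_of_in_carrier counting_zero)
next
  fix a b assume "a \<in> carrier \<T>" "b \<in> carrier \<T>"
  then obtain f g where "f \<in> counting M" "a = type_of f" "g \<in> counting M" "b = type_of g"
    by (meson carrier_type_monoidE)
  then show "a \<otimes>\<^bsub>\<T>\<^esub> b \<in> carrier \<T>" "a \<otimes>\<^bsub>\<T>\<^esub> b = b \<otimes>\<^bsub>\<T>\<^esub> a"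
    by (simp_all add: mult_type_of type_of_in_carrier counting_add add.commute)
next
  fix a b c assume "a \<in> carrier \<T>" "b \<in> carrier \<T>" "c \<in> carrier \<T>"
  then obtain f g h where "f \<in> counting M" "a = type_of f" "g \<in> counting M" "b = type_of g"
    "h \<in> counting M" "c = type_of h"
    by (meson carrier_type_monoidE)
  then show "a \<otimes>\<^bsub>\<T>\<^esub> b \<otimes>\<^bsub>\<T>\<^esub> c = a \<otimes>\<^bsub>\<T>\<^esub> (b \<otimes>\<^bsub>\<T>\<^esub> c)"
    by (simp add: mult_type_of counting_add add.assoc)
next
  fix a assume "a \<in> carrier \<T>"
  then show "\<one>\<^bsub>\<T>\<^esub> \<otimes>\<^bsub>\<T>\<^esub> a = a"
    by (elim carrier_type_monoidE) (simp add: one_type_monoid mult_type_of counting_zero)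
qed

text \<open>For the refinement postulate, the two summands on one side are replaced by equivalent ones so that
  both sides become the same function; then a common refinement exists. The remainder postulate is
  \<open>equidec_remainder\<close>.\<close>

lemma cardinal_algebra_type_monoid: "cardinal_algebra \<T> \<Sigma>\<T>"
proof (intro cardinal_algebra.intro cardinal_algebra_axioms.intro)
  show "comm_monoid \<T>"
    by (rule comm_monoid_type_monoid)
next
  fix a :: "nat \<Rightarrow> 'x family set" assume *: "\<And>n. a n \<in> carrier \<T>"
  obtain f where f: "\<And>n. f n \<in> counting M" and a: "a = (\<lambda>n. type_of (f n))"
    by (fact carrier_type_monoid_seqE[of a, OF *])
  show "\<Sigma>\<T> a \<in> carrier \<T>"
    using f by (simp add: a type_sum_type_of type_of_in_carrier counting_suminf)
  have "(\<lambda>x. \<Sum>i. f i x) = (\<lambda>x. f 0 x + (\<Sum>i. f (Suc i) x))"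
    by (rule ext) (rule suminf_Suc_ennreal)
  then show "\<Sigma>\<T> a = a 0 \<otimes>\<^bsub>\<T>\<^esub> \<Sigma>\<T> (\<lambda>n. a (Suc n))"
    using f by (simp add: a type_sum_type_of mult_type_of counting_suminf)
next
  fix a b :: "nat \<Rightarrow> 'x family set" assume *: "\<And>n. a n \<in> carrier \<T>" "\<And>n. b n \<in> carrier \<T>"
  obtain f where f: "\<And>n. f n \<in> counting M" and a: "a = (\<lambda>n. type_of (f n))"
    by (fact carrier_type_monoid_seqE[of a, OF *(1)])
  obtain g where g: "\<And>n. g n \<in> counting M" and b: "b = (\<lambda>n. type_of (g n))"
    by (fact carrier_type_monoid_seqE[of b, OF *(2)])
  have "(\<Sum>n. f n x + g n x) = (\<Sum>n. f n x) + (\<Sum>n. g n x)" for x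
    by (intro suminf_add[symmetric] summableI)
  then show "\<Sigma>\<T> (\<lambda>n. a n \<otimes>\<^bsub>\<T>\<^esub> b n) = \<Sigma>\<T> a \<otimes>\<^bsub>\<T>\<^esub> \<Sigma>\<T> b"
    using f g by (simp add: a b type_sum_type_of mult_type_of counting_suminf counting_add)
next
  fix a assume "a \<in> carrier \<T>"
  then obtain f where f: "f \<in> counting M" and a: "a = type_of f"
    by (rule carrier_type_monoidE)
  show "\<Sigma>\<T> (\<lambda>_. a) \<otimes>\<^bsub>\<T>\<^esub> \<Sigma>\<T> (\<lambda>_. a) = \<Sigma>\<T> (\<lambda>_. a)"
    using f by (simp add: a type_sum_type_of mult_type_of counting_suminf suminf_const_idem)
next
  fix a b c d
  assume *: "a \<in> carrier \<T>" "b \<in> carrier \<T>" "c \<in> carrier \<T>" "d \<in> carrier \<T>"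
    and eq: "a \<otimes>\<^bsub>\<T>\<^esub> b = c \<otimes>\<^bsub>\<T>\<^esub> d"
  obtain f1 f2 g1 g2 where c: "f1 \<in> counting M" "f2 \<in> counting M" "g1 \<in> counting M" "g2 \<in> counting M"
    and abcd: "a = type_of f1" "b = type_of f2" "c = type_of g1" "d = type_of g2"
    using * by (meson carrier_type_monoidE)
  have "equidec (\<lambda>x. f1 x + f2 x) (\<lambda>x. g1 x + g2 x)"
    using eq c by (simp add: abcd mult_type_of type_of_eq_iff counting_add)
  then obtain g1' g2' where g': "equidec g1' g1" "equidec g2' g2"
    and sum: "(\<lambda>x. f1 x + f2 x) = (\<lambda>x. g1' x + g2' x)"
    using c(3,4) by (rule equidec_lift_add)
  note g'c = equidec_counting(1)[OF g'(1)] equidec_counting(1)[OF g'(2)]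
  define F where "F = (\<lambda>i::nat. if i = 0 then f1 else if i = 1 then f2 else (\<lambda>_. 0))"
  define G where "G = (\<lambda>i::nat. if i = 0 then g1' else if i = 1 then g2' else (\<lambda>_. 0))"
  have F: "F i \<in> counting M" and G: "G i \<in> counting M" for i
    using c g'c counting_zero[of M] by (simp_all add: F_def G_def)
  have FG: "(\<Sum>i. F i x) = (\<Sum>i. G i x)" for x
    unfolding F_def G_def suminf_two using sum by (rule fun_cong)
  obtain h where h: "\<And>i j. h i j \<in> counting M" "\<And>i x. F i x = (\<Sum>j. h i j x)"
    "\<And>j x. G j x = (\<Sum>i. h i j x)"
    by (fact counting_refinement[OF F G FG])
  have zero: "h i j x = 0" if "i \<ge> 2 \<or> j \<ge> 2" for i j x
  proof -
    have le: "u k \<le> (\<Sum>k. u k)" for u :: "nat \<Rightarrow> ennreal" and k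
      using sum_le_suminf[of u "{k}"] by simp
    have "h i j x \<le> F i x" "h i j x \<le> G j x"
      unfolding h(2,3) by (rule le)+
    moreover have "F i x = 0 \<or> G j x = 0"
      using that by (auto simp: F_def G_def)
    ultimately show ?thesis by auto
  qed
  have two: "(\<Sum>k. u k) = u 0 + u 1" if "\<And>k. k \<ge> 2 \<Longrightarrow> u k = 0" for u :: "nat \<Rightarrow> ennreal"
  proof -
    have "(\<Sum>k. u k) = (\<Sum>k\<in>{0, 1}. u k)"
      using that by (intro suminf_finite) auto
    then show ?thesis by simp
  qed
  have sums: "f1 = (\<lambda>x. h 0 0 x + h 0 1 x)" "f2 = (\<lambda>x. h 1 0 x + h 1 1 x)"
    "g1' = (\<lambda>x. h 0 0 x + h 1 0 x)" "g2' = (\<lambda>x. h 0 1 x + h 1 1 x)"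
    using h(2)[of 0] h(2)[of 1] h(3)[of 0] h(3)[of 1] zero
    by (simp_all add: fun_eq_iff F_def G_def two)
  have "type_of g1 = type_of g1'" "type_of g2 = type_of g2'"
    using g' g'c c by (simp_all add: type_of_eq_iff equidec_sym)
  then show "\<exists>p q r s. p \<in> carrier \<T> \<and> q \<in> carrier \<T> \<and> r \<in> carrier \<T> \<and> s \<in> carrier \<T> \<and>
      a = p \<otimes>\<^bsub>\<T>\<^esub> q \<and> b = r \<otimes>\<^bsub>\<T>\<^esub> s \<and> c = p \<otimes>\<^bsub>\<T>\<^esub> r \<and> d = q \<otimes>\<^bsub>\<T>\<^esub> s"
    using h(1) sums
    by (intro exI[of _ "type_of (h 0 0)"] exI[of _ "type_of (h 0 1)"]
        exI[of _ "type_of (h 1 0)"] exI[of _ "type_of (h 1 1)"])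
      (simp add: abcd type_of_in_carrier mult_type_of)
next
  fix a b :: "nat \<Rightarrow> 'x family set"
  assume *: "\<And>n. a n \<in> carrier \<T>" "\<And>n. b n \<in> carrier \<T>" and eq: "\<And>n. a n = b n \<otimes>\<^bsub>\<T>\<^esub> a (Suc n)"
  obtain f where f: "\<And>n. f n \<in> counting M" and a: "a = (\<lambda>n. type_of (f n))"
    by (fact carrier_type_monoid_seqE[of a, OF *(1)])
  obtain g where g: "\<And>n. g n \<in> counting M" and b: "b = (\<lambda>n. type_of (g n))"
    by (fact carrier_type_monoid_seqE[of b, OF *(2)])
  have fg: "equidec (f n) (\<lambda>x. g n x + f (Suc n) x)" for n
    using eq[of n] f g by (simp add: a b mult_type_of type_of_eq_iff counting_add)
  obtain c where c: "c \<in> counting M" "\<And>n. equidec (f n) (\<lambda>x. c x + (\<Sum>i. g (n + i) x))"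
    by (fact equidec_remainder[of f g, OF f g fg])
  then have "a n = type_of c \<otimes>\<^bsub>\<T>\<^esub> \<Sigma>\<T> (\<lambda>i. b (n + i))" for n
    using f g by (simp add: a b type_sum_type_of mult_type_of counting_suminf counting_add type_of_eq_iff)
  then show "\<exists>c \<in> carrier \<T>. \<forall>n. a n = c \<otimes>\<^bsub>\<T>\<^esub> \<Sigma>\<T> (\<lambda>i. b (n + i))"
    using c(1) type_of_in_carrier by blast
qed

abbreviation "\<mu> \<equiv> tarski_measure M S act"

lemma tarski_measure_eq: "A \<in> sets M \<Longrightarrow> \<mu> A = type_of (indicator A)"
  by (simp add: tarski_measure_def type_rel_class single_family_in_families tally_single_family)

lemma tarski_measure_closed: "A \<in> sets M \<Longrightarrow> \<mu> A \<in> carrier \<T>"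
  by (simp add: tarski_measure_eq type_of_in_carrier counting_indicator)

lemma tarski_measure_Un:
  assumes "A \<in> sets M" "B \<in> sets M" "A \<inter> B = {}"
  shows "\<mu> (A \<union> B) = \<mu> A \<otimes>\<^bsub>\<T>\<^esub> \<mu> B"
proof -
  have "indicator (A \<union> B) x = (indicator A x + indicator B x :: ennreal)" for x
    using assms(3) by (auto simp: indicator_def)
  then have "indicator (A \<union> B) = (\<lambda>x. indicator A x + indicator B x :: ennreal)" ..
  then show ?thesis
    using assms by (simp add: tarski_measure_eq mult_type_of counting_indicator)
qed

lemma tarski_measure_UN:
  assumes "\<And>i. D i \<in> sets M" "disjoint_family D"
  shows "\<mu> (\<Union>i. D i) = \<Sigma>\<T> (\<lambda>i. \<mu> (D i))"
proof -
  have "indicator (\<Union>i. D i) = (\<lambda>x. \<Sum>i. indicator (D i) x :: ennreal)"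
    using assms(2) by (simp add: suminf_indicator fun_eq_iff)
  then show ?thesis
    using assms(1) by (simp add: tarski_measure_eq type_sum_type_of counting_indicator)
qed

end

text \<open>Monotone sequences of sets are cut into the differences of consecutive members. The types of an
  increasing sequence thereby become the partial sums of a series, those of a decreasing sequence
  the tails of a series, each added to the type of the intersection.\<close>

theorem theorem3:
  fixes M :: "'x measure" and S :: "('s, 'r) monoid_scheme" and act :: "'s \<Rightarrow> 'x \<Rightarrow> 'x"
    and T :: "'x family set monoid" and m :: "'x set \<Rightarrow> 'x family set"
  assumes "stationarily_measurable_space M S act"
  defines "T \<equiv> type_monoid M S act"
    and "m \<equiv> tarski_measure M S act"
  shows "(\<forall>A \<in> sets M. \<forall>B \<in> sets M. A \<subseteq> B \<longrightarrow> m A \<sqsubseteq>\<^bsub>alg_order T\<^esub> m B) \<and>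
    (\<forall>A :: nat \<Rightarrow> 'x set. range A \<subseteq> sets M \<longrightarrow>
       m (\<Union>i. A i) \<sqsubseteq>\<^bsub>alg_order T\<^esub> type_sum M S act (\<lambda>i. m (A i))) \<and>
    (\<forall>A :: nat \<Rightarrow> 'x set. range A \<subseteq> sets M \<longrightarrow> incseq A \<longrightarrow>
       is_lub (alg_order T) (m (\<Union>i. A i)) (range (\<lambda>i. m (A i)))) \<and>
    (\<forall>(A :: nat \<Rightarrow> 'x set) N e. range A \<subseteq> sets M \<longrightarrow> decseq A \<longrightarrow>
       e \<in> idempotents T \<longrightarrow> (\<forall>n \<ge> N. m (A n) \<in> isotropy_monoid T e) \<longrightarrow>
       is_glb (alg_order T) (m (\<Inter>i. A i) \<otimes>\<^bsub>T\<^esub> e) (range (\<lambda>i. m (A i))))"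
proof -
  interpret stationarily_measurable_space M S act
    by fact
  interpret T: cardinal_algebra T "type_sum M S act"
    unfolding T_def by (rule cardinal_algebra_type_monoid)
  have closed: "m A \<in> carrier T" if "A \<in> sets M" for A
    using that unfolding m_def T_def by (rule tarski_measure_closed)
  have Un: "m (A \<union> B) = m A \<otimes>\<^bsub>T\<^esub> m B" if "A \<in> sets M" "B \<in> sets M" "A \<inter> B = {}" for A B
    using that unfolding m_def T_def by (rule tarski_measure_Un)
  have UN: "m (\<Union>i. D i) = type_sum M S act (\<lambda>i. m (D i))"
    if "\<And>i. D i \<in> sets M" "disjoint_family D" for D
    using that unfolding m_def by (rule tarski_measure_UN)
  have mono: "m A \<sqsubseteq>\<^bsub>alg_order T\<^esub> m B" if "A \<in> sets M" "B \<in> sets M" "A \<subseteq> B" for A B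
  proof -
    have "m B = m A \<otimes>\<^bsub>T\<^esub> m (B - A)"
      using Un[of A "B - A"] that by (simp add: Un_absorb1)
    then show ?thesis
      using that closed by simp
  qed
  have disjointed_sets: "disjointed A i \<in> sets M" if "\<And>i. A i \<in> sets M" for A :: "nat \<Rightarrow> 'x set" and i
    using sets.range_disjointed_sets[of A M] that by auto
  have disjointed: "m (\<Union>i. A i) = type_sum M S act (\<lambda>i. m (disjointed A i))"
    if A: "\<And>i. A i \<in> sets M" for A
    using UN[of "disjointed A", OF disjointed_sets[OF A] disjoint_family_disjointed]
    by (simp add: UN_disjointed_eq)
  have subadditive: "m (\<Union>i. A i) \<sqsubseteq>\<^bsub>alg_order T\<^esub> type_sum M S act (\<lambda>i. m (A i))"
    if A: "\<And>i. A i \<in> sets M" for A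
    unfolding disjointed[OF A]
    using A disjointed_sets[OF A] by (intro T.Sum_mono closed mono disjointed_subset)
  have below: "is_lub (alg_order T) (m (\<Union>i. A i)) (range (\<lambda>i. m (A i)))"
    if A: "\<And>i. A i \<in> sets M" and inc: "incseq A" for A
  proof -
    have D: "m (disjointed A i) \<in> carrier T" for i
      using disjointed_sets[OF A] by (rule closed)
    have "finprod T (\<lambda>i. m (disjointed A i)) {..n} = m (A n)" for n
    proof (induction n)
      case 0
      then show ?case
        using closed[OF A] by (simp add: disjointed_def)
    next
      case (Suc n)
      have split: "A (Suc n) = disjointed A (Suc n) \<union> A n"
        and disj: "disjointed A (Suc n) \<inter> A n = {}"
        using incseq_SucD[OF inc, of n] by (auto simp: disjointed_mono[OF inc])
      have "m (A (Suc n)) = m (disjointed A (Suc n)) \<otimes>\<^bsub>T\<^esub> m (A n)"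
        by (subst split) (rule Un[OF disjointed_sets[OF A] A disj])
      then show ?case
        using Suc D by simp
    qed
    then show ?thesis
      using T.Sum_is_lub[of "\<lambda>i. m (disjointed A i)", OF D] by (simp add: disjointed[OF A])
  qed
  have above: "is_glb (alg_order T) (m (\<Inter>i. A i) \<otimes>\<^bsub>T\<^esub> e) (range (\<lambda>i. m (A i)))"
    if A: "\<And>i. A i \<in> sets M" and dec: "decseq A" and e: "e \<in> idempotents T"
      and iso: "\<And>n. n \<ge> N \<Longrightarrow> m (A n) \<in> isotropy_monoid T e" for A N e
  proof -
    define D where "D n = A n - A (Suc n)" for n
    have D: "D n \<in> sets M" for n
      using A by (simp add: D_def)
    have I: "(\<Inter>i. A i) \<in> sets M"
      using A by auto
    have disj: "disjoint_family (\<lambda>i. D (n + i))" for n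
    proof -
      have *: "D i \<inter> D j = {}" if "i < j" for i j
        using decseqD[OF dec, of "Suc i" j] that by (auto simp: D_def)
      show ?thesis
        unfolding disjoint_family_on_def
      proof (intro ballI impI)
        fix i j :: nat
        assume "i \<noteq> j"
        then consider "n + i < n + j" | "n + j < n + i" by linarith
        then show "D (n + i) \<inter> D (n + j) = {}"
          using *[of "n + i" "n + j"] *[of "n + j" "n + i"] by cases (simp_all add: Int_commute)
      qed
    qed
    have split: "A n = (\<Inter>i. A i) \<union> (\<Union>i. D (n + i))" for n
    proof (intro Set.set_eqI iffI)
      fix x assume x: "x \<in> A n"
      show "x \<in> (\<Inter>i. A i) \<union> (\<Union>i. D (n + i))"
      proof (rule ccontr)
        assume out: "x \<notin> (\<Inter>i. A i) \<union> (\<Union>i. D (n + i))"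
        have *: "x \<in> A (n + k)" for k
        proof (induction k)
          case (Suc k)
          then show ?case
            using out by (simp add: D_def)
        qed (simp add: x)
        have "x \<in> A k" for k
          using decseqD[OF dec, of k "n + k"] *[of k] by auto
        then show False
          using out by simp
      qed
    next
      fix x assume "x \<in> (\<Inter>i. A i) \<union> (\<Union>i. D (n + i))"
      then obtain k where "x \<in> A (n + k)"
        by (auto simp: D_def)
      then show "x \<in> A n"
        using decseqD[OF dec, of n "n + k"] by auto
    qed
    have m_A: "m (A n) = m (\<Inter>i. A i) \<otimes>\<^bsub>T\<^esub> type_sum M S act (\<lambda>i. m (D (n + i)))" for n
    proof -
      have "(\<Inter>i. A i) \<inter> (\<Union>i. D (n + i)) = {}"
        by (auto simp: D_def)
      moreover have "(\<Union>i. D (n + i)) \<in> sets M"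
        using D by auto
      ultimately have "m (A n) = m (\<Inter>i. A i) \<otimes>\<^bsub>T\<^esub> m (\<Union>i. D (n + i))"
        by (subst split[of n]) (rule Un[OF I])
      also have "m (\<Union>i. D (n + i)) = type_sum M S act (\<lambda>i. m (D (n + i)))"
        using D disj by (rule UN)
      finally show ?thesis .
    qed
    have "is_glb (alg_order T) (m (\<Inter>i. A i) \<otimes>\<^bsub>T\<^esub> e)
        (range (\<lambda>n. m (\<Inter>i. A i) \<otimes>\<^bsub>T\<^esub> type_sum M S act (\<lambda>i. m (D (n + i)))))"
      using iso by (intro T.Sum_tails_is_glb[where N = N] closed I D e) (simp flip: m_A)
    then show ?thesis
      unfolding m_A .
  qed
  show ?thesis
  proof (intro conjI ballI allI impI)
    fix A B assume "A \<in> sets M" "B \<in> sets M" "A \<subseteq> B"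
    then show "m A \<sqsubseteq>\<^bsub>alg_order T\<^esub> m B"
      by (rule mono)
  next
    fix A :: "nat \<Rightarrow> 'x set" assume "range A \<subseteq> sets M"
    then show "m (\<Union>i. A i) \<sqsubseteq>\<^bsub>alg_order T\<^esub> type_sum M S act (\<lambda>i. m (A i))"
      by (intro subadditive) auto
  next
    fix A :: "nat \<Rightarrow> 'x set" assume "range A \<subseteq> sets M" and inc: "incseq A"
    then have "A i \<in> sets M" for i
      by auto
    then show "is_lub (alg_order T) (m (\<Union>i. A i)) (range (\<lambda>i. m (A i)))"
      using inc by (rule below)
  next
    fix A :: "nat \<Rightarrow> 'x set" and N e
    assume "range A \<subseteq> sets M" and dec: "decseq A" and e: "e \<in> idempotents T"
      and iso: "\<forall>n \<ge> N. m (A n) \<in> isotropy_monoid T e"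
    then have A: "A i \<in> sets M" for i
      by auto
    show "is_glb (alg_order T) (m (\<Inter>i. A i) \<otimes>\<^bsub>T\<^esub> e) (range (\<lambda>i. m (A i)))"
      using A dec e by (rule above[where N = N]) (use iso in blast)
  qed
qed

end
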